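(* Let $S=\begin{pmatrix}A&B\\C&D\end{pmatrix}\in\mathrm{Sp}(d,\mathbb{R})$ with blocks $A,B,C,D\in\mathbb{R}^{d\times d}$, let $\hat S$ be a metaplectic operator with projection $S$, let $k\in\mathcal{S}'(\mathbb{R}^{2d})$ be its Schwartz kernel, and let $\tilde k=k*\varphi$ be its smoothed kernel, where $\varphi(t)=e^{-\pi|t|^2}$, $t\in\mathbb{R}^{2d}$. If $C\in\mathrm{GL}(d,\mathbb{R})$, then $\tilde k\in\mathcal{S}(\mathbb{R}^{2d})$. In particular, $k$ is quasi-diagonal.
   Context: $\mathrm{Sp}(d,\mathbb{R})$ is the group of real $2d\times 2d$ matrices with $d\times d$ blocks $\begin{pmatrix}A&B\\C&D\end{pmatrix}$ satisfying $A^TC=C^TA$, $B^TD=D^TB$, $A^TD-C^TB=I$. Metaplectic operators. For $(x,\xi;\tau)\in\mathbb{R}^d\times\mathbb{R}^d\times\mathbb{R}$ and $f\in L^2(\mathbb{R}^d)$ let $\rho(x,\xi;\tau)f(t)=e^{2\pi i\tau}e^{-i\pi x\cdot\xi}e^{2\pi i\xi\cdot t}f(t-x)$. A metaplectic operator with projection $S$ is a unitary operator $\hat S$ on $L^2(\mathbb{R}^d)$ with $\hat S\rho(x,\xi;\tau)\hat S^{-1}=\rho(S(x,\xi);\tau)$ for all $(x,\xi;\tau)$; it exists and is unique up to a phase factor (a complex constant of modulus $1$). $\hat S$ maps $\mathcal{S}(\mathbb{R}^d)$ to $\mathcal{S}(\mathbb{R}^d)$ continuously. Schwartz kernel. The kernel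 of a continuous linear $T:\mathcal{S}(\mathbb{R}^d)\to\mathcal{S}'(\mathbb{R}^d)$ is the distribution $k\in\mathcal{S}'(\mathbb{R}^{2d})$ such that, formally, $Tf(x)=\int_{\mathbb{R}^d}k(x,y)f(y)\,dy$ for $f\in\mathcal{S}(\mathbb{R}^d)$. Quasi-diagonality. Let $\langle x\rangle=(1+|x|^2)^{1/2}$. A continuous function $h$ on $\mathbb{R}^{2d}$ is a diagonal kernel if for every integer $N>0$ there is $C_N>0$ with $|h(x,y)|\le C_N\langle x-y\rangle^{-N}$ for all $x,y\in\mathbb{R}^d$. A distribution $k\in\mathcal{S}'(\mathbb{R}^{2d})$ is quasi-diagonal if $\tilde k=k*\varphi$ is a diagonal kernel. *)

theory Defs
  imports "HOL-Analysis.Analysis"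
begin

section \<open>Schwartz functions and tempered distributions\<close>

definition japanese :: "'a::real_normed_vector \<Rightarrow> real" where
  "japanese x = sqrt (1 + (norm x)\<^sup>2)"

text \<open>Iterated directional derivatives along a list of vectors; for vectors taken from
  \<open>Basis\<close> these are the iterated partial derivatives.\<close>

primrec iter_deriv :: "'a list \<Rightarrow> ('a::real_normed_vector \<Rightarrow> 'b::real_normed_vector) \<Rightarrow> 'a \<Rightarrow> 'b" where
  "iter_deriv [] f = f"
| "iter_deriv (v # vs) f = (\<lambda>x. frechet_derivative (iter_deriv vs f) (at x) v)"

text \<open>All iterated partial derivatives being totally differentiable (hence continuous) is the
  same as being of class \<open>C\<^sup>\<infinity>\<close>. The differentiability requirement also ensures that
  \<^const>\<open>frechet_derivative\<close> is never applied outside its domain of meaning.\<close>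

definition smooth :: "('a::euclidean_space \<Rightarrow> 'b::real_normed_vector) \<Rightarrow> bool" where
  "smooth f \<longleftrightarrow> (\<forall>vs x. set vs \<subseteq> Basis \<longrightarrow> iter_deriv vs f differentiable (at x))"

definition schwartz :: "('a::euclidean_space \<Rightarrow> complex) set" where
  "schwartz = {f. smooth f \<and>
     (\<forall>N vs. set vs \<subseteq> Basis \<longrightarrow>
        bdd_above (range (\<lambda>x. japanese x ^ N * norm (iter_deriv vs f x))))}"

definition schwartz_seminorm :: "nat \<Rightarrow> ('a::euclidean_space \<Rightarrow> complex) \<Rightarrow> real" where
  "schwartz_seminorm N f =
     (\<Sum>vs\<in>{vs. set vs \<subseteq> Basis \<and> length vs \<le> N}.
        SUP x. japanese x ^ N * norm (iter_deriv vs f x))"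

text \<open>A distribution is represented by its (bilinear) pairing with test functions; its values
  outside \<open>schwartz\<close> are irrelevant. The seminorms above are increasing in \<open>N\<close> and generate
  the topology of the Schwartz space, so the estimate below is continuity.\<close>

definition tempered :: "(('a::euclidean_space \<Rightarrow> complex) \<Rightarrow> complex) set" where
  "tempered = {u.
     (\<forall>f\<in>schwartz. \<forall>g\<in>schwartz. u (\<lambda>x. f x + g x) = u f + u g) \<and>
     (\<forall>c. \<forall>f\<in>schwartz. u (\<lambda>x. c * f x) = c * u f) \<and>
     (\<exists>C N. \<forall>f\<in>schwartz. norm (u f) \<le> C * schwartz_seminorm N f)}"

definition distr_of_fun :: "('a::euclidean_space \<Rightarrow> complex) \<Rightarrow> ('a \<Rightarrow> complex) \<Rightarrow> complex" where
  "distr_of_fun h g = (LINT x|lborel. h x * g x)"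

definition distr_convolution ::
  "(('a::euclidean_space \<Rightarrow> complex) \<Rightarrow> complex) \<Rightarrow> ('a \<Rightarrow> complex) \<Rightarrow> 'a \<Rightarrow> complex" where
  "distr_convolution u f z = u (\<lambda>w. f (z - w))"

text \<open>\<open>k\<close> is the kernel of \<open>T\<close> if \<open>\<langle>T f, g\<rangle> = \<langle>k, g \<otimes> f\<rangle>\<close> for all test functions, which is the
  meaning of the formal identity \<open>T f x = \<integral> k (x, y) f y dy\<close>.\<close>

definition schwartz_kernel ::
  "(('a::euclidean_space \<times> 'b::euclidean_space \<Rightarrow> complex) \<Rightarrow> complex) \<Rightarrow>
   (('b \<Rightarrow> complex) \<Rightarrow> ('a \<Rightarrow> complex) \<Rightarrow> complex) \<Rightarrow> bool" where
  "schwartz_kernel k T \<longleftrightarrow> k \<in> tempered \<and>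
     (\<forall>f\<in>schwartz. \<forall>g\<in>schwartz. T f g = k (\<lambda>(x, y). g x * f y))"


section \<open>Unitary operators on the space of square-integrable functions\<close>

text \<open>Elements of \<open>L\<^sup>2\<close> are represented by Borel functions, with equality almost everywhere.\<close>

definition L2 :: "('a::euclidean_space \<Rightarrow> complex) set" where
  "L2 = {f. f \<in> borel_measurable lborel \<and> integrable lborel (\<lambda>x. (norm (f x))\<^sup>2)}"

definition L2_eq :: "('a::euclidean_space \<Rightarrow> complex) \<Rightarrow> ('a \<Rightarrow> complex) \<Rightarrow> bool" where
  "L2_eq f g \<longleftrightarrow> (AE x in lborel. f x = g x)"

definition L2_inner :: "('a::euclidean_space \<Rightarrow> complex) \<Rightarrow> ('a \<Rightarrow> complex) \<Rightarrow> complex" where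
  "L2_inner f g = (LINT x|lborel. f x * cnj (g x))"

text \<open>A linear operator on \<open>L\<^sup>2\<close>, acting on representatives compatibly with \<^const>\<open>L2_eq\<close>.\<close>

definition L2_operator ::
  "(('a::euclidean_space \<Rightarrow> complex) \<Rightarrow> ('a \<Rightarrow> complex)) \<Rightarrow> bool" where
  "L2_operator U \<longleftrightarrow>
     (\<forall>f\<in>L2. U f \<in> L2) \<and>
     (\<forall>f\<in>L2. \<forall>g\<in>L2. L2_eq f g \<longrightarrow> L2_eq (U f) (U g)) \<and>
     (\<forall>f\<in>L2. \<forall>g\<in>L2. L2_eq (U (\<lambda>x. f x + g x)) (\<lambda>x. U f x + U g x)) \<and>
     (\<forall>c. \<forall>f\<in>L2. L2_eq (U (\<lambda>x. c * f x)) (\<lambda>x. c * U f x))"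

definition L2_unitary ::
  "(('a::euclidean_space \<Rightarrow> complex) \<Rightarrow> ('a \<Rightarrow> complex)) \<Rightarrow> bool" where
  "L2_unitary U \<longleftrightarrow> L2_operator U \<and>
     (\<forall>f\<in>L2. \<forall>g\<in>L2. L2_inner (U f) (U g) = L2_inner f g) \<and>
     (\<forall>g\<in>L2. \<exists>f\<in>L2. L2_eq (U f) g)"

definition L2_inverse ::
  "(('a::euclidean_space \<Rightarrow> complex) \<Rightarrow> ('a \<Rightarrow> complex)) \<Rightarrow>
   (('a \<Rightarrow> complex) \<Rightarrow> ('a \<Rightarrow> complex)) \<Rightarrow> bool" where
  "L2_inverse U V \<longleftrightarrow> L2_operator V \<and>
     (\<forall>f\<in>L2. L2_eq (U (V f)) f) \<and> (\<forall>f\<in>L2. L2_eq (V (U f)) f)"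


section \<open>The symplectic group and metaplectic operators\<close>

definition block_matrix ::
  "real^'n^'n \<Rightarrow> real^'n^'n \<Rightarrow> real^'n^'n \<Rightarrow> real^'n^'n \<Rightarrow> real^('n + 'n)^('n::finite + 'n)" where
  "block_matrix A B C D = (\<chi> i j.
     case (i, j) of (Inl p, Inl q) \<Rightarrow> A $ p $ q | (Inl p, Inr q) \<Rightarrow> B $ p $ q
                  | (Inr p, Inl q) \<Rightarrow> C $ p $ q | (Inr p, Inr q) \<Rightarrow> D $ p $ q)"

definition stack :: "real^'n \<Rightarrow> real^'n \<Rightarrow> real^('n::finite + 'n)" where
  "stack x \<xi> = (\<chi> i. case i of Inl p \<Rightarrow> x $ p | Inr p \<Rightarrow> \<xi> $ p)"

definition Sp :: "(real^('n::finite + 'n)^('n + 'n)) set" where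
  "Sp = {block_matrix A B C D | A B C D.
     transpose A ** C = transpose C ** A \<and>
     transpose B ** D = transpose D ** B \<and>
     transpose A ** D - transpose C ** B = mat 1}"

definition rho ::
  "real^'n \<Rightarrow> real^'n \<Rightarrow> real \<Rightarrow> (real^'n \<Rightarrow> complex) \<Rightarrow> real^'n::finite \<Rightarrow> complex" where
  "rho x \<xi> \<tau> f = (\<lambda>t. exp (2 * pi * \<i> * \<tau>) * exp (- (\<i> * pi * (x \<bullet> \<xi>))) *
     exp (2 * pi * \<i> * (\<xi> \<bullet> t)) * f (t - x))"

definition metaplectic ::
  "real^('n + 'n)^('n + 'n) \<Rightarrow> ((real^'n::finite \<Rightarrow> complex) \<Rightarrow> (real^'n \<Rightarrow> complex)) \<Rightarrow> bool" where
  "metaplectic S U \<longleftrightarrow> L2_unitary U \<and>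
     (\<exists>V. L2_inverse U V \<and>
        (\<forall>x \<xi> x' \<xi>' \<tau>. S *v stack x \<xi> = stack x' \<xi>' \<longrightarrow>
           (\<forall>f\<in>L2. L2_eq (U (rho x \<xi> \<tau> (V f))) (rho x' \<xi>' \<tau> f))))"


section \<open>Quasi-diagonality\<close>

definition gaussian :: "'a::euclidean_space \<Rightarrow> complex" where
  "gaussian t = exp (- (pi * (norm t)\<^sup>2))"

definition diagonal_kernel :: "('a::euclidean_space \<times> 'a \<Rightarrow> complex) \<Rightarrow> bool" where
  "diagonal_kernel h \<longleftrightarrow> continuous_on UNIV h \<and>
     (\<forall>N::int. N > 0 \<longrightarrow> (\<exists>C>0. \<forall>x y. norm (h (x, y)) \<le> C * japanese (x - y) powi (- N)))"

definition quasi_diagonal ::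
  "(('a::euclidean_space \<times> 'a \<Rightarrow> complex) \<Rightarrow> complex) \<Rightarrow> bool" where
  "quasi_diagonal k \<longleftrightarrow> k \<in> tempered \<and> diagonal_kernel (distr_convolution k gaussian)"

end

theory Submission
  imports Defs "HOL-Probability.Characteristic_Functions"
begin

text \<open>
  Write \<open>T\<^sub>a\<close> for the Gaussian translated to \<open>a\<close>. The smoothed kernel is the matrix coefficient
  \<open>h (x, y) = \<langle>U T\<^sub>y, T\<^sub>x\<rangle>\<close> of the metaplectic operator \<open>U\<close>. Integrating \<open>\<langle>\<rho>(p, \<xi>) u, v\<rangle>\<close> against
  a suitable Gaussian weight in \<open>(p, \<xi>)\<close> yields \<open>\<langle>u, T\<^sub>y\<^sub>0\<rangle> \<langle>T\<^sub>y, v\<rangle>\<close> up to a constant. For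
  \<open>u = U\<inverse> T\<^sub>x\<^sub>0\<close> and \<open>v = U\<inverse> T\<^sub>x\<close> this product is \<open>cnj (h (x0, y0)) * h (x, y)\<close>, whereas the
  intertwining property turns \<open>\<langle>\<rho>(p, \<xi>) u, v\<rangle>\<close> into the explicit coefficient
  \<open>\<langle>\<rho>(S (p, \<xi>)) T\<^sub>x\<^sub>0, T\<^sub>x\<rangle>\<close>. So, unless \<open>h\<close> vanishes identically, it is a multiple of a
  partial integral over \<open>(p, \<xi>)\<close> of the exponential of a quadratic polynomial in \<open>(x, y, p, \<xi>)\<close>.
  The real part of this polynomial controls \<open>p - y\<close>, \<open>\<xi>\<close>, \<open>A p + B \<xi> - x\<close> and \<open>C p + D \<xi>\<close>;
  if \<open>C\<close> is invertible, these determine all four variables, and partial integrals of Gaussians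
  are Schwartz functions. In this way neither the existence nor an explicit formula for
  metaplectic operators is needed.
\<close>

section \<open>Polynomials times Gaussians\<close>

text \<open>Polynomial functions without coordinates: the generators are real-linear functionals
  with complex values. Growth bounds and closure under differentiation then follow by rule
  induction.\<close>

inductive cpoly :: "('a::real_normed_vector \<Rightarrow> complex) \<Rightarrow> bool" where
  const: "cpoly (\<lambda>_. c)"
| linear: "bounded_linear f \<Longrightarrow> cpoly f"
| add: "cpoly f \<Longrightarrow> cpoly g \<Longrightarrow> cpoly (\<lambda>x. f x + g x)"
| mult: "cpoly f \<Longrightarrow> cpoly g \<Longrightarrow> cpoly (\<lambda>x. f x * g x)"

lemma cpoly_sum: "(\<And>i. i \<in> I \<Longrightarrow> cpoly (f i)) \<Longrightarrow> cpoly (\<lambda>x. \<Sum>i\<in>I. f i x)"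
  by (induction I rule: infinite_finite_induct) (auto intro: cpoly.intros)

lemma cpoly_affine: "bounded_linear f \<Longrightarrow> cpoly (\<lambda>x. f x + c)"
  by (intro cpoly.intros)

text \<open>Expanding the inner product in an orthonormal basis turns it into a sum of products of
  affine functionals. All quadratic exponents below are assembled from such terms.\<close>

lemma cpoly_inner_affine:
  fixes f g :: "'a::real_normed_vector \<Rightarrow> 'b::euclidean_space"
  assumes f: "bounded_linear f" and g: "bounded_linear g"
  shows "cpoly (\<lambda>x. complex_of_real ((f x + a) \<bullet> (g x + b)))"
proof -
  have *: "complex_of_real ((f x + a) \<bullet> (g x + b)) =
      (\<Sum>e\<in>Basis. (complex_of_real (f x \<bullet> e) + complex_of_real (a \<bullet> e)) *
        (complex_of_real (g x \<bullet> e) + complex_of_real (b \<bullet> e)))" for x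
    by (subst euclidean_inner) (simp add: inner_add_left)
  have lin: "bounded_linear (\<lambda>x. complex_of_real (h x \<bullet> e))"
    if "bounded_linear h" for h :: "'a \<Rightarrow> 'b" and e
    using that
    by (intro bounded_linear_compose[OF bounded_linear_of_real]
        bounded_linear_compose[OF bounded_linear_inner_left])
  show ?thesis
    unfolding * by (intro cpoly_sum cpoly.mult cpoly_affine lin f g)
qed

lemma cpoly_growth:
  assumes "cpoly P"
  shows "\<exists>C N. C \<ge> 0 \<and> (\<forall>x. norm (P x) \<le> C * (1 + norm x) ^ N)"
  using assms
proof induction
  case (const c)
  show ?case by (rule exI[of _ "norm c"], rule exI[of _ 0]) auto
next
  case (linear f)
  then obtain K where K: "\<And>x. norm (f x) \<le> norm x * K" "K \<ge> 0"
    using bounded_linear.nonneg_bounded by blast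
  have "norm (f x) \<le> K * (1 + norm x) ^ 1" for x
    using K(1)[of x] K(2) by (simp add: algebra_simps)
  then show ?case using K(2) by blast
next
  case (add f g)
  then obtain C N C' N' where *: "C \<ge> 0" "\<And>x. norm (f x) \<le> C * (1 + norm x) ^ N"
    "C' \<ge> 0" "\<And>x. norm (g x) \<le> C' * (1 + norm x) ^ N'" by blast
  have "norm (f x + g x) \<le> (C + C') * (1 + norm x) ^ (N + N')" for x
  proof -
    have "norm (f x + g x) \<le> C * (1 + norm x) ^ N + C' * (1 + norm x) ^ N'"
      using *(2)[of x] *(4)[of x] norm_triangle_ineq[of "f x" "g x"] by linarith
    also have "\<dots> \<le> C * (1 + norm x) ^ (N + N') + C' * (1 + norm x) ^ (N + N')"
      using * by (intro add_mono mult_left_mono power_increasing) auto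
    finally show ?thesis by (simp add: algebra_simps)
  qed
  then show ?case using * by (intro exI[of _ "C + C'"] exI[of _ "N + N'"]) auto
next
  case (mult f g)
  then obtain C N C' N' where *: "C \<ge> 0" "\<And>x. norm (f x) \<le> C * (1 + norm x) ^ N"
    "C' \<ge> 0" "\<And>x. norm (g x) \<le> C' * (1 + norm x) ^ N'" by blast
  have "norm (f x * g x) \<le> (C * C') * (1 + norm x) ^ (N + N')" for x
  proof -
    have "norm (f x * g x) \<le> (C * (1 + norm x) ^ N) * (C' * (1 + norm x) ^ N')"
      unfolding norm_mult using * by (intro mult_mono) auto
    then show ?thesis by (simp add: power_add mult_ac)
  qed
  then show ?case using * by (intro exI[of _ "C * C'"] exI[of _ "N + N'"]) auto
qed

text \<open>The direction \<open>v\<close> is the first argument of \<open>P'\<close>, so that a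
  derivative in a fixed direction is again a polynomial in the base point. This is the form that
  iteration of directional derivatives requires.\<close>

lemma cpoly_has_derivative:
  assumes "cpoly P"
  shows "\<exists>P'. (\<forall>v. cpoly (P' v)) \<and> (\<forall>x. (P has_derivative (\<lambda>v. P' v x)) (at x))"
  using assms
proof induction
  case (const c)
  show ?case by (rule exI[of _ "\<lambda>_ _. 0"]) (auto intro: cpoly.intros)
next
  case (linear f)
  then show ?case
    by (intro exI[of _ "\<lambda>v _. f v"]) (auto intro: cpoly.intros bounded_linear_imp_has_derivative)
next
  case (add f g)
  then obtain f' g' where "\<And>v. cpoly (f' v)" "\<And>x. (f has_derivative (\<lambda>v. f' v x)) (at x)"
    "\<And>v. cpoly (g' v)" "\<And>x. (g has_derivative (\<lambda>v. g' v x)) (at x)" by blast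
  then show ?case
    by (intro exI[of _ "\<lambda>v x. f' v x + g' v x"]) (auto intro: cpoly.intros has_derivative_add)
next
  case (mult f g)
  then obtain f' g' where *: "\<And>v. cpoly (f' v)" "\<And>x. (f has_derivative (\<lambda>v. f' v x)) (at x)"
    "\<And>v. cpoly (g' v)" "\<And>x. (g has_derivative (\<lambda>v. g' v x)) (at x)" by blast
  show ?case
    by (intro exI[of _ "\<lambda>v x. f x * g' v x + f' v x * g x"] conjI allI has_derivative_mult *
        cpoly.add cpoly.mult mult.hyps)
qed

text \<open>Differentiation reproduces the factor \<open>exp (q x)\<close>, so for fixed
  \<open>q\<close> the functions \<open>P x * exp (q x)\<close> form a class closed under
  directional derivatives.\<close>

lemma cpoly_exp_has_derivative:
  assumes "cpoly P" "cpoly q"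
  shows "\<exists>P'. (\<forall>v. cpoly (P' v)) \<and>
    (\<forall>x. ((\<lambda>x. P x * exp (q x)) has_derivative (\<lambda>v. P' v x * exp (q x))) (at x))"
proof -
  obtain P' q' where *: "\<And>v. cpoly (P' v)" "\<And>x. (P has_derivative (\<lambda>v. P' v x)) (at x)"
    "\<And>v. cpoly (q' v)" "\<And>x. (q has_derivative (\<lambda>v. q' v x)) (at x)"
    using assms[THEN cpoly_has_derivative] by blast
  have "((\<lambda>x. exp (q x)) has_derivative (\<lambda>v. q' v x * exp (q x))) (at x)" for x
  proof -
    have "(exp has_derivative (\<lambda>v. exp (q x) * v)) (at (q x))"
      using DERIV_exp[of "q x"] by (simp add: has_field_derivative_def)
    from has_derivative_compose[OF *(4) this] show ?thesis by (simp add: mult.commute)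
  qed
  from has_derivative_mult[OF *(2) this]
  have "((\<lambda>x. P x * exp (q x)) has_derivative
      (\<lambda>v. (P x * q' v x + P' v x) * exp (q x))) (at x)" for x
    by (simp add: algebra_simps)
  then show ?thesis
    by (intro exI[of _ "\<lambda>v x. P x * q' v x + P' v x"] conjI allI cpoly.add cpoly.mult * assms)
qed

lemma cpoly_borel_measurable: "cpoly P \<Longrightarrow> P \<in> borel_measurable borel"
  by (intro borel_measurable_continuous_onI continuous_at_imp_continuous_on ballI)
    (meson cpoly_has_derivative has_derivative_continuous)

text \<open>A single term of the exponential series gives
  \<open>(1 + r) ^ N \<le> fact N * exp (1 + r)\<close>; completing a square then bounds the linear
  exponent by \<open>c * r\<^sup>2\<close> plus a constant.\<close>

lemma power_le_exp_square:
  fixes c :: real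
  assumes "c > 0"
  shows "\<exists>K\<ge>0. \<forall>r\<ge>0. (1 + r) ^ N \<le> K * exp (c * r\<^sup>2)"
proof -
  have "(1 + r) ^ N \<le> (fact N * exp (1 + 1 / (4 * c))) * exp (c * r\<^sup>2)" if r: "r \<ge> 0" for r :: real
  proof -
    have s: "(\<lambda>n. (1 + r) ^ n /\<^sub>R fact n) sums exp (1 + r)" by (rule exp_converges)
    have "(1 + r) ^ N /\<^sub>R fact N \<le> exp (1 + r)"
      using sum_le_suminf[OF sums_summable[OF s], of "{N}"] r sums_unique[OF s] by auto
    then have "(1 + r) ^ N \<le> fact N * exp (1 + r)"
      by (simp add: field_simps)
    also have "1 + r \<le> (1 + 1 / (4 * c)) + c * r\<^sup>2"
    proof -
      \<comment> \<open>The point \<open>1 / (2 * c)\<close> maximises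
        \<open>r - c * r\<^sup>2\<close>, with maximum \<open>1 / (4 * c)\<close>.\<close>
      have "0 \<le> c * (r - 1 / (2 * c))\<^sup>2" using assms by simp
      also have "\<dots> = c * r\<^sup>2 - r + 1 / (4 * c)"
        using assms by (simp add: power2_eq_square field_simps)
      finally show ?thesis by simp
    qed
    then have "fact N * exp (1 + r) \<le> fact N * exp ((1 + 1 / (4 * c)) + c * r\<^sup>2)" by simp
    finally show ?thesis by (simp add: exp_add)
  qed
  then show ?thesis by (intro exI[of _ "fact N * exp (1 + 1 / (4 * c))"]) auto
qed

text \<open>Half of the quadratic decay of the exponential is spent on absorbing the growth of
  \<open>P\<close>; the other half remains.\<close>

lemma cpoly_exp_bound:
  assumes "cpoly P" and q: "\<And>x. Re (q x) \<le> K - c * (norm x)\<^sup>2" and "c > 0"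
  shows "\<exists>C\<ge>0. \<forall>x. norm (P x * exp (q x)) \<le> C * exp (- (c / 2) * (norm x)\<^sup>2)"
proof -
  obtain C N where C: "C \<ge> 0" "\<And>x. norm (P x) \<le> C * (1 + norm x) ^ N"
    using cpoly_growth[OF assms(1)] by blast
  obtain K' where K': "K' \<ge> 0" "\<And>r. r \<ge> 0 \<Longrightarrow> (1 + r) ^ N \<le> K' * exp (c / 2 * r\<^sup>2)"
    using power_le_exp_square[of "c / 2" N] \<open>c > 0\<close> by auto
  have "norm (P x * exp (q x)) \<le> C * K' * exp K * exp (- (c / 2) * (norm x)\<^sup>2)" for x
  proof -
    have "norm (P x) \<le> C * (K' * exp (c / 2 * (norm x)\<^sup>2))"
      using C(2)[of x] mult_left_mono[OF K'(2)[of "norm x"] C(1)] by simp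
    moreover have "norm (exp (q x)) \<le> exp (K - c * (norm x)\<^sup>2)"
      using q[of x] by simp
    ultimately have "norm (P x * exp (q x)) \<le>
        C * (K' * exp (c / 2 * (norm x)\<^sup>2)) * exp (K - c * (norm x)\<^sup>2)"
      unfolding norm_mult using C K' by (intro mult_mono) auto
    also have "\<dots> = C * K' * (exp (c / 2 * (norm x)\<^sup>2) * exp (K - c * (norm x)\<^sup>2))"
      by simp
    also have "exp (c / 2 * (norm x)\<^sup>2) * exp (K - c * (norm x)\<^sup>2) =
        exp K * exp (- (c / 2) * (norm x)\<^sup>2)"
      by (simp add: exp_add[symmetric])
    finally show ?thesis by simp
  qed
  then show ?thesis using C K' by (intro exI[of _ "C * K' * exp K"]) auto
qed

section \<open>Membership in the Schwartz space\<close>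

lemma japanese_le: "japanese x \<le> 1 + norm x"
  unfolding japanese_def by (rule real_le_lsqrt) (auto simp: power2_eq_square algebra_simps)

lemma japanese_power_exp_bound:
  fixes c :: real
  assumes "c > 0"
  shows "\<exists>K\<ge>0. \<forall>x::'a::real_normed_vector. japanese x ^ N * exp (- c * (norm x)\<^sup>2) \<le> K"
proof -
  obtain K where K: "K \<ge> 0" "\<And>r. r \<ge> 0 \<Longrightarrow> (1 + r) ^ N \<le> K * exp (c * r\<^sup>2)"
    using power_le_exp_square[OF assms] by auto
  have "japanese x ^ N * exp (- c * (norm x)\<^sup>2) \<le> K" for x :: 'a
  proof -
    have "japanese x ^ N \<le> (1 + norm x) ^ N"
      by (intro power_mono japanese_le) (simp add: japanese_def)
    also have "\<dots> \<le> K * exp (c * (norm x)\<^sup>2)" using K by simp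
    finally have "japanese x ^ N * exp (- c * (norm x)\<^sup>2) \<le>
        K * exp (c * (norm x)\<^sup>2) * exp (- c * (norm x)\<^sup>2)"
      by (intro mult_right_mono) auto
    also have "\<dots> = K" by (simp add: mult.assoc exp_add[symmetric])
    finally show ?thesis .
  qed
  then show ?thesis using K by blast
qed

text \<open>If a class is closed under directional derivatives, every iterated derivative of a
  member is again a member. Decay then has to be checked only for the members themselves.\<close>

lemma schwartz_subsetI:
  fixes X :: "('a::euclidean_space \<Rightarrow> complex) set"
  assumes deriv: "\<And>f. f \<in> X \<Longrightarrow>
      \<exists>f'. (\<forall>v. f' v \<in> X) \<and> (\<forall>x. (f has_derivative (\<lambda>v. f' v x)) (at x))"
    and bound: "\<And>f N. f \<in> X \<Longrightarrow> bdd_above (range (\<lambda>x. japanese x ^ N * norm (f x)))"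
  shows "X \<subseteq> schwartz"
proof
  fix f assume f: "f \<in> X"
  have *: "iter_deriv vs f \<in> X" for vs
  proof (induction vs)
    case (Cons v vs)
    then obtain f' where f': "\<And>v. f' v \<in> X"
      "\<And>x. (iter_deriv vs f has_derivative (\<lambda>v. f' v x)) (at x)"
      using deriv by blast
    have "iter_deriv (v # vs) f = f' v"
      by (simp add: frechet_derivative_at[OF f'(2), symmetric])
    then show ?case using f'(1) by simp
  qed (simp add: f)
  have "iter_deriv vs f differentiable (at x)" for vs x
    using deriv[OF *] by (meson differentiableI)
  then show "f \<in> schwartz"
    unfolding schwartz_def smooth_def by (simp add: bound[OF *])
qed

lemma gaussian_decay_imp_schwartz_bound:
  fixes f :: "'a::real_normed_vector \<Rightarrow> complex"
  assumes "\<And>x. norm (f x) \<le> C * exp (- c * (norm x)\<^sup>2)" "c > 0"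
  shows "bdd_above (range (\<lambda>x. japanese x ^ N * norm (f x)))"
proof -
  obtain K where K: "\<And>x::'a. japanese x ^ N * exp (- c * (norm x)\<^sup>2) \<le> K"
    using japanese_power_exp_bound[OF assms(2)] by blast
  have "0 \<le> C" using order_trans[OF norm_ge_zero assms(1)[of 0]] by simp
  have "japanese x ^ N * norm (f x) \<le> C * K" for x
  proof -
    have "japanese x ^ N * norm (f x) \<le> japanese x ^ N * (C * exp (- c * (norm x)\<^sup>2))"
      by (intro mult_left_mono assms) (simp add: japanese_def)
    also have "\<dots> \<le> C * K" using mult_left_mono[OF K[of x] \<open>0 \<le> C\<close>] by (simp add: mult_ac)
    finally show ?thesis .
  qed
  then show ?thesis by (intro bdd_aboveI[of _ "C * K"]) auto
qed

text \<open>The class to use consists of all products of a polynomial with the one fixed factor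
  \<open>exp (q x)\<close>.\<close>

lemma cpoly_exp_schwartz:
  fixes q :: "'a::euclidean_space \<Rightarrow> complex"
  assumes P: "cpoly P" and q: "cpoly q" "\<And>x. Re (q x) \<le> K - c * (norm x)\<^sup>2" "c > 0"
  shows "(\<lambda>x. P x * exp (q x)) \<in> schwartz"
proof -
  define X where "X = {\<lambda>x. P x * exp (q x) |P. cpoly P}"
  have "X \<subseteq> schwartz"
  proof (rule schwartz_subsetI)
    fix f assume "f \<in> X"
    then obtain P where P: "f = (\<lambda>x. P x * exp (q x))" "cpoly P" by (auto simp: X_def)
    show "\<exists>f'. (\<forall>v. f' v \<in> X) \<and> (\<forall>x. (f has_derivative (\<lambda>v. f' v x)) (at x))"
    proof -
      obtain P' where P': "\<And>v. cpoly (P' v)"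
        "\<And>x. ((\<lambda>x. P x * exp (q x)) has_derivative (\<lambda>v. P' v x * exp (q x))) (at x)"
        using cpoly_exp_has_derivative[OF P(2) q(1)] by blast
      then show ?thesis
        unfolding P by (intro exI[of _ "\<lambda>v x. P' v x * exp (q x)"]) (auto simp: X_def)
    qed
    fix N
    show "bdd_above (range (\<lambda>x. japanese x ^ N * norm (f x)))"
    proof -
      obtain C where "\<And>x. norm (P x * exp (q x)) \<le> C * exp (- (c / 2) * (norm x)\<^sup>2)"
        using cpoly_exp_bound[OF P(2) q(2,3)] by blast
      then show ?thesis
        unfolding P(1) by (rule gaussian_decay_imp_schwartz_bound) (use q in simp)
    qed
  qed
  then show ?thesis using P by (auto simp: X_def)
qed

section \<open>Differentiation under the integral sign\<close>

text \<open>Dominated convergence for the remainder divided by \<open>norm h\<close>. The majorant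
  \<open>K\<close> is uniform in the base point \<open>x\<close>, so the mean value inequality also
  controls the increments of \<open>F\<close>.\<close>

lemma has_derivative_integral_dominated:
  fixes F :: "'a::euclidean_space \<Rightarrow> 'b \<Rightarrow> 'c::{banach, second_countable_topology}"
  assumes deriv: "\<And>x z. ((\<lambda>x. F x z) has_derivative (\<lambda>v. F' x v z)) (at x)"
    and int: "\<And>x. integrable M (F x)"
    and meas: "\<And>x v. F' x v \<in> borel_measurable M"
    and bound: "\<And>x v z. norm (F' x v z) \<le> norm v * K z"
    and K: "integrable M K"
  shows "((\<lambda>x. \<integral>z. F x z \<partial>M) has_derivative (\<lambda>v. \<integral>z. F' x v z \<partial>M)) (at x)"
proof -
  have int': "integrable M (F' x v)" for v
    by (rule Bochner_Integration.integrable_bound[OF integrable_mult_right[OF K, of "norm v"]])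
      (use bound[of x v] in \<open>auto simp: meas intro!: AE_I2 order_trans[OF _ abs_ge_self]\<close>)
  have lin: "linear (\<lambda>v. F' x v z)" for z
    using deriv[of z x] by (rule has_derivative_linear)
  have bl: "bounded_linear (\<lambda>v. \<integral>z. F' x v z \<partial>M)"
  proof (rule linear_conv_bounded_linear[THEN iffD1], rule linearI)
    show "(\<integral>z. F' x (v + w) z \<partial>M) = (\<integral>z. F' x v z \<partial>M) + (\<integral>z. F' x w z \<partial>M)" for v w
      by (simp add: linear_add[OF lin] Bochner_Integration.integral_add int')
    show "(\<integral>z. F' x (r *\<^sub>R v) z \<partial>M) = r *\<^sub>R (\<integral>z. F' x v z \<partial>M)" for r v
      by (simp add: linear_scale[OF lin])
  qed
  \<comment> \<open>Mean value inequality: \<open>K z\<close> bounds the operator norm of the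
    derivative at every point.\<close>
  have lip: "norm (F (x + h) z - F x z) \<le> norm h * K z" for h z
    using differentiable_bound[of UNIV "\<lambda>x. F x z" "\<lambda>x v. F' x v z" "K z" "x + h" x]
      deriv bound by (auto simp: onorm_le mult.commute)
  \<comment> \<open>Dominated convergence speaks of sequences, so the limit
    \<open>h \<rightarrow> 0\<close> is tested along sequences \<open>X\<close> of nonzero vectors.
    The majorant is \<open>2 * K z\<close>: one \<open>K z\<close> for the increment and one for the
    linear term.\<close>
  have lim: "(\<lambda>n. \<integral>z. (F (x + X n) z - F x z - F' x (X n) z) /\<^sub>R norm (X n) \<partial>M) \<longlonglongrightarrow> (\<integral>z. 0 \<partial>M)"
    if X: "\<forall>n. X n \<noteq> 0" "X \<longlonglongrightarrow> 0" for X
  proof (rule integral_dominated_convergence)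
    show "integrable M (\<lambda>z. 2 * K z)" using K by simp
    show "(\<lambda>z. (F (x + X n) z - F x z - F' x (X n) z) /\<^sub>R norm (X n)) \<in> borel_measurable M" for n
      using int[THEN borel_measurable_integrable] meas by simp
    show "AE z in M. (\<lambda>n. (F (x + X n) z - F x z - F' x (X n) z) /\<^sub>R norm (X n)) \<longlonglongrightarrow> 0"
    proof (rule AE_I2)
      fix z
      have "(\<lambda>h. (F (x + h) z - F x z - F' x h z) /\<^sub>R norm h) \<midarrow>0\<rightarrow> 0"
        using deriv[of z x] unfolding has_derivative_at
        by (subst tendsto_norm_zero_iff[symmetric]) (simp add: divide_inverse mult.commute)
      then show "(\<lambda>n. (F (x + X n) z - F x z - F' x (X n) z) /\<^sub>R norm (X n)) \<longlonglongrightarrow> 0"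
        using X unfolding tendsto_at_iff_sequentially comp_def by auto
    qed
    show "AE z in M. norm ((F (x + X n) z - F x z - F' x (X n) z) /\<^sub>R norm (X n)) \<le> 2 * K z" for n
    proof (rule AE_I2)
      fix z
      have "norm (F (x + X n) z - F x z - F' x (X n) z) \<le> norm (X n) * (2 * K z)"
        using norm_triangle_ineq4[of "F (x + X n) z - F x z" "F' x (X n) z"]
          lip[of "X n" z] bound[of x "X n" z] by simp
      then have "norm (F (x + X n) z - F x z - F' x (X n) z) / norm (X n) \<le> 2 * K z"
        using X(1)[rule_format, of n] by (simp add: pos_divide_le_eq mult_ac)
      then show "norm ((F (x + X n) z - F x z - F' x (X n) z) /\<^sub>R norm (X n)) \<le> 2 * K z"
        by (simp add: divide_inverse mult.commute)
    qed
  qed simp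
  have eq: "(\<integral>z. (F (x + h) z - F x z - F' x h z) /\<^sub>R norm h \<partial>M) =
      ((\<integral>z. F (x + h) z \<partial>M) - (\<integral>z. F x z \<partial>M) - (\<integral>z. F' x h z \<partial>M)) /\<^sub>R norm h" for h
    by (simp add: int int')
  have "(\<lambda>h. ((\<integral>z. F (x + h) z \<partial>M) - (\<integral>z. F x z \<partial>M) - (\<integral>z. F' x h z \<partial>M)) /\<^sub>R norm h)
      \<midarrow>0\<rightarrow> 0"
    unfolding tendsto_at_iff_sequentially comp_def eq[symmetric]
    using lim by (simp only: Bochner_Integration.integral_zero) auto
  then show ?thesis
    unfolding has_derivative_at using bl
    by (subst (asm) tendsto_norm_zero_iff[symmetric]) (simp add: divide_inverse mult.commute)
qed

section \<open>Gaussian integrals\<close>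

text \<open>The characteristic function of the standard normal distribution covers
  \<open>a = 1/2\<close>; the substitution \<open>x \<mapsto> c * x\<close> with
  \<open>c = sqrt (2 * a)\<close> gives the general case.\<close>

lemma gaussian_fourier_real:
  fixes a s :: real
  assumes "a > 0"
  shows "has_bochner_integral lborel
    (\<lambda>x::real. exp (complex_of_real (- (a * x\<^sup>2)) + \<i> * complex_of_real (s * x)))
    (complex_of_real (sqrt (pi / a) * exp (- s\<^sup>2 / (4 * a))))"
proof -
  define f where "f t x = exp (complex_of_real (- (x\<^sup>2 / 2)) + \<i> * complex_of_real (t * x))"
    for t x :: real
  have f_eq: "f t x = complex_of_real (sqrt (2 * pi)) * (std_normal_density x *\<^sub>R iexp (t * x))"
    for t x
    unfolding f_def exp_add
    by (simp add: std_normal_density_def scaleR_conv_of_real exp_of_real[symmetric])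
  have "integrable lborel (\<lambda>x. std_normal_density x *\<^sub>R iexp (t * x))" for t
    by (rule Bochner_Integration.integrable_bound[OF integrable_normal_density[where \<mu>=0 and \<sigma>=1]]) auto
  then have int: "integrable lborel (f t)" for t
    unfolding f_eq[abs_def] by (rule integrable_mult_right)
  have "(LINT x|lborel. std_normal_density x *\<^sub>R iexp (t * x)) = complex_of_real (exp (- t\<^sup>2 / 2))" for t
    using fun_cong[OF char_std_normal_distribution, of t]
    unfolding char_def by (subst (asm) integral_density) auto
  then have "integral\<^sup>L lborel (f t) = complex_of_real (sqrt (2 * pi) * exp (- t\<^sup>2 / 2))" for t
    unfolding f_eq[abs_def] by (simp only: integral_mult_right_zero of_real_mult)
  with int have base: "has_bochner_integral lborel (f t)
      (complex_of_real (sqrt (2 * pi) * exp (- t\<^sup>2 / 2)))" for t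
    by (simp add: has_bochner_integral_iff)
  define c where "c = sqrt (2 * a)"
  have c: "c > 0" "c\<^sup>2 = 2 * a" using assms by (auto simp: c_def)
  have "has_bochner_integral lborel (\<lambda>x. f (s / c) (0 + c * x))
      (complex_of_real (sqrt (2 * pi) * exp (- (s / c)\<^sup>2 / 2)) /\<^sub>R \<bar>c\<bar>)"
    using base[of "s / c"] c
    by (subst lborel_has_bochner_integral_real_affine_iff[where c=c and t=0, symmetric]) auto
  moreover have "f (s / c) (0 + c * x) =
      exp (complex_of_real (- (a * x\<^sup>2)) + \<i> * complex_of_real (s * x))" for x
    using c by (simp add: f_def power_mult_distrib)
  moreover have "complex_of_real (sqrt (2 * pi) * exp (- (s / c)\<^sup>2 / 2)) /\<^sub>R \<bar>c\<bar> =
      complex_of_real (sqrt (pi / a) * exp (- s\<^sup>2 / (4 * a)))"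
  proof -
    have "sqrt (2 * pi) / c = sqrt (pi / a)"
      unfolding c_def by (simp add: real_sqrt_divide[symmetric])
    then have "sqrt (2 * pi) * exp (- (s / c)\<^sup>2 / 2) / \<bar>c\<bar> = sqrt (pi / a) * exp (- s\<^sup>2 / (4 * a))"
      using c by (simp add: power_divide field_simps)
    moreover have "complex_of_real A /\<^sub>R r = complex_of_real (A / r)" for A r
      by (simp add: scaleR_conv_of_real divide_inverse mult.commute)
    ultimately show ?thesis by (simp only:)
  qed
  ultimately show ?thesis by simp
qed

text \<open>Lebesgue measure is the image of a product of one-dimensional Lebesgue measures under
  \<open>T\<close>, and the integrand factors over the coordinates.\<close>

lemma gaussian_fourier:
  fixes s :: "'a::euclidean_space"
  assumes "a > 0"
  shows "has_bochner_integral lborel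
    (\<lambda>x. exp (complex_of_real (- (a * (norm x)\<^sup>2)) + \<i> * complex_of_real (s \<bullet> x)))
    (complex_of_real (sqrt (pi / a) ^ DIM('a) * exp (- (norm s)\<^sup>2 / (4 * a))))"
proof -
  interpret product_sigma_finite "\<lambda>_::'a. lborel :: real measure" ..
  define g where "g b x = exp (complex_of_real (- (a * x\<^sup>2)) + \<i> * complex_of_real ((s \<bullet> b) * x))"
    for b :: 'a and x :: real
  define h where "h x = exp (complex_of_real (- (a * (norm x)\<^sup>2)) + \<i> * complex_of_real (s \<bullet> x))"
    for x :: 'a
  define T where "T f = (\<Sum>b\<in>Basis. f b *\<^sub>R b)" for f :: "'a \<Rightarrow> real"
  have norm_sum: "(norm x)\<^sup>2 = (\<Sum>b\<in>Basis. (x \<bullet> b)\<^sup>2)" for x :: 'a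
    unfolding power2_norm_eq_inner by (subst euclidean_inner) (simp add: power2_eq_square)
  have h_T: "h (T f) = (\<Prod>b\<in>Basis. g b (f b))" for f
  proof -
    have T: "T f \<bullet> b = f b" if "b \<in> Basis" for b using that by (simp add: T_def)
    have "complex_of_real (- (a * (norm (T f))\<^sup>2)) + \<i> * complex_of_real (s \<bullet> T f) =
        (\<Sum>b\<in>Basis. complex_of_real (- (a * (f b)\<^sup>2)) + \<i> * complex_of_real ((s \<bullet> b) * f b))"
      unfolding norm_sum
      by (subst euclidean_inner[of s])
        (simp add: T sum_subtractf sum_distrib_left)
    then show ?thesis
      unfolding h_def g_def by (simp add: exp_sum)
  qed
  have g: "has_bochner_integral lborel (g b)
      (complex_of_real (sqrt (pi / a) * exp (- (s \<bullet> b)\<^sup>2 / (4 * a))))" for b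
    unfolding g_def by (rule gaussian_fourier_real[OF assms])
  have T_meas: "T \<in> measurable (\<Pi>\<^sub>M b\<in>Basis. lborel) borel"
    unfolding T_def by measurable
  have h_meas: "h \<in> borel_measurable borel"
    unfolding h_def by (intro borel_measurable_continuous_onI continuous_intros)
  have "integrable (\<Pi>\<^sub>M b\<in>Basis. lborel) (\<lambda>f. h (T f))"
    unfolding h_T using g by (intro product_integrable_prod) (auto simp: has_bochner_integral_iff)
  then have 1: "integrable lborel h"
    by (subst lborel_eq) (simp add: integrable_distr_eq[OF _ h_meas] T_meas[unfolded T_def] T_def)
  have "integral\<^sup>L lborel h = (LINT f|(\<Pi>\<^sub>M b\<in>Basis. lborel). h (T f))"
    by (subst lborel_eq) (simp add: integral_distr[OF _ h_meas] T_meas[unfolded T_def] T_def)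
  also have "\<dots> = (\<Prod>b\<in>Basis. integral\<^sup>L lborel (g b))"
    unfolding h_T using g by (intro product_integral_prod) (auto simp: has_bochner_integral_iff)
  also have "\<dots> = (\<Prod>b\<in>(Basis::'a set). complex_of_real (sqrt (pi / a) * exp (- (s \<bullet> b)\<^sup>2 / (4 * a))))"
    using g by (auto simp: has_bochner_integral_iff)
  also have "\<dots> = complex_of_real (sqrt (pi / a) ^ DIM('a) * exp (\<Sum>b\<in>Basis. - (s \<bullet> b)\<^sup>2 / (4 * a)))"
    by (simp add: prod.distrib exp_sum)
  also have "(\<Sum>b\<in>Basis. - (s \<bullet> b)\<^sup>2 / (4 * a)) = - (norm s)\<^sup>2 / (4 * a)"
    unfolding norm_sum by (simp add: sum_divide_distrib sum_negf)
  finally show ?thesis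
    using 1 unfolding has_bochner_integral_iff h_def by simp
qed

lemma integrable_gaussian:
  fixes a :: real
  assumes "a > 0"
  shows "integrable lborel (\<lambda>x::'a::euclidean_space. exp (- (a * (norm x)\<^sup>2)))"
proof -
  have "integrable lborel
      (\<lambda>x::'a. exp (complex_of_real (- (a * (norm x)\<^sup>2)) + \<i> * complex_of_real (0 \<bullet> x)))"
    using gaussian_fourier[OF assms, of "0::'a"] by (simp add: has_bochner_integral_iff)
  from integrable_norm[OF this] show ?thesis by simp
qed

section \<open>Translations, reflections and partial Gaussian integrals\<close>

text \<open>The condition on \<open>c\<close> leaves the values 1 and -1, so translations and point
  reflections are treated together.\<close>

lemma distr_lborel_isometry:
  fixes t :: "'a::euclidean_space"
  assumes "\<bar>c\<bar> = 1"
  shows "distr lborel borel (\<lambda>x. t + c *\<^sub>R x) = lborel"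
  using lborel_affine[of c t] assms by (auto simp: density_1)

lemma
  fixes f :: "'a::euclidean_space \<Rightarrow> 'b::{banach, second_countable_topology}"
  assumes f: "f \<in> borel_measurable borel" and c: "\<bar>c\<bar> = 1"
  shows integral_lborel_isometry: "(LINT x|lborel. f (t + c *\<^sub>R x)) = integral\<^sup>L lborel f"
    and integrable_lborel_isometry: "integrable lborel (\<lambda>x. f (t + c *\<^sub>R x)) \<longleftrightarrow> integrable lborel f"
proof -
  have m: "(\<lambda>x. t + c *\<^sub>R x) \<in> measurable lborel borel" by measurable
  show "(LINT x|lborel. f (t + c *\<^sub>R x)) = integral\<^sup>L lborel f"
    using integral_distr[OF m f] by (simp add: distr_lborel_isometry[OF c])
  show "integrable lborel (\<lambda>x. f (t + c *\<^sub>R x)) \<longleftrightarrow> integrable lborel f"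
    using integrable_distr_eq[OF m f] by (simp add: distr_lborel_isometry[OF c])
qed

text \<open>Since \<open>norm (x, z)\<close> squared is the sum of the two squared norms, the
  Gaussian bound splits into a factor in \<open>x\<close> and an integrable factor in
  \<open>z\<close>. Differentiating under the integral along \<open>(v, 0)\<close> keeps the
  integrand in the class of polynomials times \<open>exp q\<close>, so
  \<open>schwartz_subsetI\<close> applies to the class of all these integrals.\<close>

lemma cpoly_exp_integral_schwartz:
  fixes q :: "'a::euclidean_space \<times> 'b::euclidean_space \<Rightarrow> complex"
  assumes P: "cpoly P" and q: "cpoly q" "\<And>w. Re (q w) \<le> K - c * (norm w)\<^sup>2" "c > 0"
  shows "(\<lambda>x. LINT z|lborel. P (x, z) * exp (q (x, z))) \<in> schwartz"
proof -
  define G where "G P x = (LINT z|lborel. P (x, z) * exp (q (x, z)))"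
    for P :: "'a \<times> 'b \<Rightarrow> complex" and x
  have bound: "\<exists>C\<ge>0. \<forall>x z. norm (P (x, z) * exp (q (x, z))) \<le>
      C * exp (- (c / 2) * (norm x)\<^sup>2) * exp (- (c / 2 * (norm z)\<^sup>2))" if P: "cpoly P" for P
  proof -
    obtain C where C: "C \<ge> 0" "\<And>w. norm (P w * exp (q w)) \<le> C * exp (- (c / 2) * (norm w)\<^sup>2)"
      using cpoly_exp_bound[OF P q(2,3)] by blast
    have "exp (- (c / 2) * (norm (x, z))\<^sup>2) =
        exp (- (c / 2) * (norm x)\<^sup>2) * exp (- (c / 2 * (norm z)\<^sup>2))" for x :: 'a and z :: 'b
      by (simp add: norm_Pair exp_add[symmetric] algebra_simps add_divide_distrib)
    then have "norm (P (x, z) * exp (q (x, z))) \<le>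
        C * exp (- (c / 2) * (norm x)\<^sup>2) * exp (- (c / 2 * (norm z)\<^sup>2))" for x z
      using C(2)[of "(x, z)"] by (simp only: mult.assoc)
    then show ?thesis using C(1) by blast
  qed
  have gauss: "integrable lborel (\<lambda>z::'b. C * exp (- (c / 2 * (norm z)\<^sup>2)))" for C
    by (intro integrable_mult_right integrable_gaussian) (use q in simp)
  have meas: "(\<lambda>z. P (x, z) * exp (q (x, z))) \<in> borel_measurable borel" if "cpoly P" for P x
  proof -
    have [measurable]: "P \<in> borel_measurable (borel \<Otimes>\<^sub>M borel)" "q \<in> borel_measurable (borel \<Otimes>\<^sub>M borel)"
      using that q by (auto simp: borel_prod intro: cpoly_borel_measurable)
    show ?thesis by measurable
  qed
  have int: "integrable lborel (\<lambda>z. P (x, z) * exp (q (x, z)))" if P: "cpoly P" for P x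
  proof -
    obtain C where C: "\<And>x z. norm (P (x, z) * exp (q (x, z))) \<le>
      C * exp (- (c / 2) * (norm x)\<^sup>2) * exp (- (c / 2 * (norm z)\<^sup>2))"
      using bound[OF P] by blast
    show ?thesis
      by (rule Bochner_Integration.integrable_bound[OF gauss])
        (use meas[OF P] C[of x] in \<open>auto intro!: AE_I2 order_trans[OF _ abs_ge_self]\<close>)
  qed
  have "G ` {P. cpoly P} \<subseteq> schwartz"
  proof (rule schwartz_subsetI)
    fix f assume "f \<in> G ` {P. cpoly P}"
    then obtain P where P: "f = G P" "cpoly P" by auto
    obtain P' where P': "\<And>v. cpoly (P' v)"
      "\<And>w. ((\<lambda>w. P w * exp (q w)) has_derivative (\<lambda>v. P' v w * exp (q w))) (at w)"
      using cpoly_exp_has_derivative[OF P(2) q(1)] by blast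
    have deriv: "((\<lambda>x. P (x, z) * exp (q (x, z))) has_derivative
        (\<lambda>v. P' (v, 0) (x, z) * exp (q (x, z)))) (at x)" for x z
    proof -
      have "((\<lambda>x. (x, z)) has_derivative (\<lambda>v. (v, 0))) (at x)"
        by (auto intro!: derivative_eq_intros)
      from has_derivative_compose[OF this P'(2)] show ?thesis .
    qed
    have "\<forall>v. \<exists>C\<ge>0. \<forall>x z. norm (P' v (x, z) * exp (q (x, z))) \<le>
      C * exp (- (c / 2) * (norm x)\<^sup>2) * exp (- (c / 2 * (norm z)\<^sup>2))"
      using bound[OF P'(1)] by blast
    then obtain C where C: "\<And>v. C v \<ge> 0" "\<And>v x z. norm (P' v (x, z) * exp (q (x, z))) \<le>
      C v * exp (- (c / 2) * (norm x)\<^sup>2) * exp (- (c / 2 * (norm z)\<^sup>2))" by metis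
    \<comment> \<open>The constants \<open>C v\<close> come from a separate bound for each direction
      and are not known to depend linearly on \<open>v\<close>. Linearity of the derivative reduces
      to the finitely many basis directions and yields a bound proportional to
      \<open>norm v\<close>.\<close>
    define K where "K = (\<Sum>b\<in>Basis. C (b, 0))"
    have le: "norm (P' (v, 0) (x, z) * exp (q (x, z))) \<le>
        norm v * (K * exp (- (c / 2 * (norm z)\<^sup>2)))" for v x z
    proof -
      have lin: "linear (\<lambda>v. P' (v, 0) (x, z) * exp (q (x, z)))"
        using deriv by (rule has_derivative_linear)
      have "P' (v, 0) (x, z) * exp (q (x, z)) =
          (\<Sum>b\<in>Basis. (v \<bullet> b) *\<^sub>R (P' (b, 0) (x, z) * exp (q (x, z))))"
        by (subst euclidean_representation[of v, symmetric])
          (simp only: linear_sum[OF lin] linear_scale[OF lin])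
      then have "norm (P' (v, 0) (x, z) * exp (q (x, z))) \<le>
          (\<Sum>b\<in>Basis. norm ((v \<bullet> b) *\<^sub>R (P' (b, 0) (x, z) * exp (q (x, z)))))"
        by (simp only: norm_sum)
      also have "\<dots> \<le> (\<Sum>b\<in>Basis. norm v * (C (b, 0) * exp (- (c / 2 * (norm z)\<^sup>2))))"
      proof (rule sum_mono)
        fix b :: 'a assume b: "b \<in> Basis"
        \<comment> \<open>The decaying factor in \<open>x\<close> is replaced by 1, because the
          majorant must not depend on \<open>x\<close>.\<close>
        have "norm (P' (b, 0) (x, z) * exp (q (x, z))) \<le>
            C (b, 0) * 1 * exp (- (c / 2 * (norm z)\<^sup>2))"
          using C(1) \<open>c > 0\<close>
          by (intro order_trans[OF C(2)] mult_right_mono mult_left_mono) auto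
        then show "norm ((v \<bullet> b) *\<^sub>R (P' (b, 0) (x, z) * exp (q (x, z)))) \<le>
            norm v * (C (b, 0) * exp (- (c / 2 * (norm z)\<^sup>2)))"
          unfolding norm_scaleR using Basis_le_norm[OF b, of v] by (intro mult_mono) auto
      qed
      also have "\<dots> = norm v * (K * exp (- (c / 2 * (norm z)\<^sup>2)))"
        by (simp add: K_def sum_distrib_left sum_distrib_right)
      finally show ?thesis .
    qed
    have "(G P has_derivative (\<lambda>v. G (P' (v, 0)) x)) (at x)" for x
      unfolding G_def[abs_def]
      by (rule has_derivative_integral_dominated[OF deriv int _ le gauss])
        (use P P' meas in auto)
    then show "\<exists>f'. (\<forall>v. f' v \<in> G ` {P. cpoly P}) \<and> (\<forall>x. (f has_derivative (\<lambda>v. f' v x)) (at x))"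
      unfolding P(1) using P'(1) by (intro exI[of _ "\<lambda>v. G (P' (v, 0))"]) auto
    fix N
    obtain C0 where C0: "C0 \<ge> 0" "\<And>x z. norm (P (x, z) * exp (q (x, z))) \<le>
      C0 * exp (- (c / 2) * (norm x)\<^sup>2) * exp (- (c / 2 * (norm z)\<^sup>2))"
      using bound[OF P(2)] by blast
    have "norm (G P x) \<le> (C0 * (LINT z::'b|lborel. exp (- (c / 2 * (norm z)\<^sup>2)))) *
        exp (- (c / 2) * (norm x)\<^sup>2)" for x
    proof -
      have "norm (G P x) \<le> (LINT z|lborel. norm (P (x, z) * exp (q (x, z))))"
        unfolding G_def by (rule integral_norm_bound)
      also have "\<dots> \<le> (LINT z::'b|lborel. (C0 * exp (- (c / 2) * (norm x)\<^sup>2)) * exp (- (c / 2 * (norm z)\<^sup>2)))"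
        by (intro integral_mono integrable_norm int gauss P(2) C0(2))
      finally show ?thesis by (simp add: mult_ac)
    qed
    then show "bdd_above (range (\<lambda>x. japanese x ^ N * norm (f x)))"
      unfolding P(1) by (rule gaussian_decay_imp_schwartz_bound) (use q in simp)
  qed
  then show ?thesis using P unfolding G_def[abs_def] by blast
qed

section \<open>Gaussian averages of the Schroedinger representation\<close>

lemma gaussian_eq: "gaussian t = complex_of_real (exp (- (pi * (norm t)\<^sup>2)))"
  by (simp add: gaussian_def exp_of_real[symmetric])

lemma gaussian_minus_commute: "gaussian (x - y) = gaussian (y - x)"
  by (simp add: gaussian_eq norm_minus_commute)

lemma gaussian_Pair: "gaussian (x, y) = gaussian x * gaussian y"
  by (simp add: gaussian_eq norm_Pair distrib_left exp_add[symmetric] flip: of_real_mult)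

lemma gaussian_borel_measurable [measurable]:
  "gaussian \<in> borel_measurable (borel :: 'a::euclidean_space measure)"
  unfolding gaussian_def by measurable

lemma cnj_borel_measurable [measurable]: "cnj \<in> borel_measurable borel"
  by (intro borel_measurable_continuous_onI continuous_intros)

text \<open>Parallelogram identity around the midpoint of \<open>a\<close> and \<open>b\<close>: the
  product is a Gaussian centred there, with a height governed by the distance from \<open>a\<close>
  to \<open>b\<close>.\<close>

lemma gaussian_mult:
  fixes t :: "'a::euclidean_space"
  shows "gaussian (t - a) * gaussian (t - b) =
    complex_of_real (exp (- (pi / 2 * (norm (a - b))\<^sup>2)) *
      exp (- (2 * pi * (norm (t - (1/2) *\<^sub>R (a + b)))\<^sup>2)))"
proof -
  have "(norm (t - a))\<^sup>2 + (norm (t - b))\<^sup>2 =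
      (norm (a - b))\<^sup>2 / 2 + 2 * (norm (t - (1/2) *\<^sub>R (a + b)))\<^sup>2"
    unfolding power2_norm_eq_inner by (simp add: algebra_simps inner_commute add_divide_distrib diff_divide_distrib)
  then have "- (pi * (norm (t - a))\<^sup>2) + - (pi * (norm (t - b))\<^sup>2) =
      - (pi / 2 * (norm (a - b))\<^sup>2) + - (2 * pi * (norm (t - (1/2) *\<^sub>R (a + b)))\<^sup>2)"
    by (simp add: algebra_simps flip: distrib_left)
  then show ?thesis
    unfolding gaussian_eq of_real_mult[symmetric] exp_add[symmetric] by (rule arg_cong)
qed

lemma gaussian_translate_L2: "(\<lambda>t. gaussian (t - a)) \<in> L2"
proof -
  have "integrable lborel (\<lambda>t::'a. exp (- (2 * pi * (norm t)\<^sup>2)))"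
    by (rule integrable_gaussian) simp
  then have "integrable lborel (\<lambda>t::'a. exp (- (2 * pi * (norm (- a + 1 *\<^sub>R t))\<^sup>2)))"
    by (subst integrable_lborel_isometry) auto
  moreover have "(norm (gaussian (t - a)))\<^sup>2 = exp (- (2 * pi * (norm (- a + 1 *\<^sub>R t))\<^sup>2))" for t
    by (simp add: gaussian_eq exp_double[symmetric] mult.assoc flip: exp_of_nat_mult)
  ultimately show ?thesis by (simp add: L2_def)
qed

text \<open>Shifting the variable to the midpoint \<open>m\<close> reduces this to the Fourier
  transform of one centred Gaussian; the shift produces the phase in
  \<open>\<xi> \<bullet> (a + b)\<close>.\<close>

lemma gaussian_translate_fourier:
  fixes \<xi> :: "'a::euclidean_space"
  shows "(LINT t|lborel. exp (\<i> * complex_of_real (2 * pi * (\<xi> \<bullet> t))) *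
      (gaussian (t - a) * gaussian (t - b))) =
    complex_of_real (sqrt (1/2) ^ DIM('a)) *
      exp (complex_of_real (- (pi / 2 * ((norm (a - b))\<^sup>2 + (norm \<xi>)\<^sup>2))) +
        \<i> * complex_of_real (pi * (\<xi> \<bullet> (a + b))))"
proof -
  define m where "m = (1/2) *\<^sub>R (a + b)"
  have "(LINT t|lborel. exp (\<i> * complex_of_real (2 * pi * (\<xi> \<bullet> t))) *
      (gaussian (t - a) * gaussian (t - b))) =
    (LINT t|lborel. exp (\<i> * complex_of_real (2 * pi * (\<xi> \<bullet> (m + 1 *\<^sub>R t)))) *
      (gaussian ((m + 1 *\<^sub>R t) - a) * gaussian ((m + 1 *\<^sub>R t) - b)))"
    by (rule integral_lborel_isometry[symmetric]) auto
  also have "\<dots> = (LINT t|lborel. exp (complex_of_real (- (pi / 2 * (norm (a - b))\<^sup>2)) +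
        \<i> * complex_of_real (pi * (\<xi> \<bullet> (a + b)))) *
      exp (complex_of_real (- (2 * pi * (norm t)\<^sup>2)) + \<i> * complex_of_real (((2 * pi) *\<^sub>R \<xi>) \<bullet> t)))"
    unfolding gaussian_mult m_def[symmetric]
    by (rule Bochner_Integration.integral_cong)
      (auto simp: m_def algebra_simps simp flip: exp_of_real exp_add)
  also have "\<dots> = exp (complex_of_real (- (pi / 2 * (norm (a - b))\<^sup>2)) +
        \<i> * complex_of_real (pi * (\<xi> \<bullet> (a + b)))) *
      complex_of_real (sqrt (1/2) ^ DIM('a) * exp (- (pi / 2 * (norm \<xi>)\<^sup>2)))"
  proof -
    have "(LINT t|lborel. exp (complex_of_real (- (2 * pi * (norm t)\<^sup>2)) +
          \<i> * complex_of_real (((2 * pi) *\<^sub>R \<xi>) \<bullet> t))) =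
        complex_of_real (sqrt (pi / (2 * pi)) ^ DIM('a) *
          exp (- (norm ((2 * pi) *\<^sub>R \<xi>))\<^sup>2 / (4 * (2 * pi))))"
      using gaussian_fourier[of "2 * pi" "(2 * pi) *\<^sub>R \<xi>"] by (simp add: has_bochner_integral_iff)
    also have "- (norm ((2 * pi) *\<^sub>R \<xi>))\<^sup>2 / (4 * (2 * pi)) = - (pi / 2 * (norm \<xi>)\<^sup>2)"
      by (simp add: power_mult_distrib power2_eq_square)
    also have "pi / (2 * pi) = 1 / 2" by simp
    finally show ?thesis by simp
  qed
  also have "\<dots> = complex_of_real (sqrt (1/2) ^ DIM('a)) *
      exp (complex_of_real (- (pi / 2 * ((norm (a - b))\<^sup>2 + (norm \<xi>)\<^sup>2))) +
        \<i> * complex_of_real (pi * (\<xi> \<bullet> (a + b))))"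
    by (simp add: exp_add[symmetric] distrib_left flip: exp_of_real)
      (simp add: algebra_simps flip: exp_add)
  finally show ?thesis .
qed

lemma rho_zero:
  "rho p \<xi> 0 u t = exp (\<i> * complex_of_real (2 * pi * (\<xi> \<bullet> t) - pi * (p \<bullet> \<xi>))) * u (t - p)"
  by (simp add: rho_def exp_add[symmetric] algebra_simps)

lemma rho_zero_L2:
  assumes "u \<in> L2"
  shows "rho p \<xi> 0 u \<in> L2"
proof -
  have [measurable]: "u \<in> borel_measurable borel" using assms by (simp add: L2_def)
  have "integrable lborel (\<lambda>t. (norm (u (- p + 1 *\<^sub>R t)))\<^sup>2)"
    using assms by (subst integrable_lborel_isometry) (auto simp: L2_def)
  moreover have "rho p \<xi> 0 u \<in> borel_measurable borel"
    unfolding rho_zero[abs_def] by measurable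
  ultimately show ?thesis
    by (simp add: L2_def rho_zero norm_mult)
qed

text \<open>The average of \<^const>\<open>rho\<close> against a Gaussian weight is a rank-one operator.\<close>

lemma rho_gaussian_average:
  fixes u v :: "real^'n::finite \<Rightarrow> complex"
  assumes u: "u \<in> L2" and v: "v \<in> L2"
  shows "(LINT (p, \<xi>)|lborel.
      exp (complex_of_real (- (pi / 2 * ((norm (p + a - b))\<^sup>2 + (norm \<xi>)\<^sup>2))) -
        \<i> * complex_of_real (pi * (\<xi> \<bullet> (a + b)))) * L2_inner (rho p \<xi> 0 u) v) =
    complex_of_real (sqrt 2 ^ CARD('n)) *
      (L2_inner u (\<lambda>t. gaussian (t - a)) * L2_inner (\<lambda>t. gaussian (t - b)) v)"
proof -
  have [measurable]: "u \<in> borel_measurable borel" "v \<in> borel_measurable borel"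
    using u v by (auto simp: L2_def)
  \<comment> \<open>Up to the factor \<open>sqrt 2 ^ CARD('n)\<close>, this weight is the complex
    conjugate of the Gaussian coefficient computed in \<open>rho_gaussian_inner\<close>. The
    identity is thus an instance of the orthogonality relations (Moyal's formula) for the
    Schroedinger representation.\<close>
  define W where "W z = exp (complex_of_real (- (pi / 2 * ((norm (fst z + a - b))\<^sup>2 + (norm (snd z))\<^sup>2))) -
        \<i> * complex_of_real (pi * (snd z \<bullet> (a + b))))" for z :: "(real^'n) \<times> (real^'n)"
  define H where "H z t = W z * (rho (fst z) (snd z) 0 u t * cnj (v t))" for z t
  have W_meas [measurable]: "W \<in> borel_measurable (borel \<Otimes>\<^sub>M borel)"
    unfolding W_def by measurable
  have H_meas: "case_prod H \<in> borel_measurable ((borel \<Otimes>\<^sub>M borel) \<Otimes>\<^sub>M borel)"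
    unfolding H_def rho_zero by measurable
  then have H_meas' [measurable]: "case_prod H \<in> borel_measurable (lborel \<Otimes>\<^sub>M lborel)"
    unfolding borel_prod lborel_prod by simp
  have norm_H: "norm (H z t) = norm (W z) * (norm (u (t - fst z)) * norm (v t))" for z t
    by (simp add: H_def rho_zero norm_mult)
  have W_int: "integrable lborel (\<lambda>z. norm (W z))"
  proof -
    have "integrable lborel (\<lambda>z::(real^'n) \<times> (real^'n). exp (- (pi / 2 * (norm z)\<^sup>2)))"
      by (rule integrable_gaussian) simp
    then have "integrable lborel
        (\<lambda>z::(real^'n) \<times> (real^'n). exp (- (pi / 2 * (norm ((a - b, 0) + 1 *\<^sub>R z))\<^sup>2)))"
      by (subst integrable_lborel_isometry) auto
    moreover have "norm (W z) = exp (- (pi / 2 * (norm ((a - b, 0) + 1 *\<^sub>R z))\<^sup>2))" for z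
      by (cases z) (simp add: W_def norm_Pair algebra_simps)
    ultimately show ?thesis by simp
  qed
  \<comment> \<open>Bounding a product by the sum of the squares separates \<open>u\<close> from
    \<open>v\<close>; by translation invariance the resulting integral over \<open>t\<close> equals
    \<open>U\<close> for every \<open>z\<close>. So \<open>norm (W z) * U\<close> is an integrable
    majorant for Fubini's theorem.\<close>
  define U where "U = (LINT t|lborel. (norm (u t))\<^sup>2) + (LINT t|lborel. (norm (v t))\<^sup>2)"
  have u_shift: "integrable lborel (\<lambda>t. (norm (u (t - p)))\<^sup>2)"
    "(LINT t|lborel. (norm (u (t - p)))\<^sup>2) = (LINT t|lborel. (norm (u t))\<^sup>2)" for p
    using u integrable_lborel_isometry[of "\<lambda>t. (norm (u t))\<^sup>2" 1 "- p"]
      integral_lborel_isometry[of "\<lambda>t. (norm (u t))\<^sup>2" 1 "- p"]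
    by (auto simp: L2_def)
  have v_int: "integrable lborel (\<lambda>t. (norm (v t))\<^sup>2)" using v by (simp add: L2_def)
  have dom_int: "integrable lborel (\<lambda>t. norm (W z) * ((norm (u (t - fst z)))\<^sup>2 + (norm (v t))\<^sup>2))" for z
    by (intro integrable_mult_right Bochner_Integration.integrable_add u_shift v_int)
  have H_le: "norm (H z t) \<le> norm (W z) * ((norm (u (t - fst z)))\<^sup>2 + (norm (v t))\<^sup>2)" for z t
  proof -
    have "x * y \<le> x\<^sup>2 + y\<^sup>2" if "x \<ge> 0" "y \<ge> 0" for x y :: real
      using that sum_squares_bound[of x y] mult_nonneg_nonneg[OF that] by linarith
    then show ?thesis unfolding norm_H by (intro mult_left_mono) auto
  qed
  have H_int_t: "integrable lborel (H z)" for z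
  proof (rule Bochner_Integration.integrable_bound[OF dom_int[of z]])
    show "H z \<in> borel_measurable lborel" unfolding H_def rho_zero by measurable
    show "AE t in lborel. norm (H z t) \<le> norm (norm (W z) * ((norm (u (t - fst z)))\<^sup>2 + (norm (v t))\<^sup>2))"
      using H_le by (intro AE_I2 order_trans[OF H_le]) simp
  qed
  have H_int: "integrable (lborel \<Otimes>\<^sub>M lborel) (case_prod H)"
  proof (rule lborel_pair.Fubini_integrable[OF H_meas'])
    show "integrable lborel (\<lambda>z. LINT t|lborel. norm (case (z, t) of (z, t) \<Rightarrow> H z t))"
    proof (rule Bochner_Integration.integrable_bound[OF integrable_mult_left[OF W_int, of U]])
      show "(\<lambda>z. LINT t|lborel. norm (case (z, t) of (z, t) \<Rightarrow> H z t)) \<in> borel_measurable lborel"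
        by measurable
      have "(LINT t|lborel. norm (H z t)) \<le> norm (W z) * U" for z
      proof -
        have "(LINT t|lborel. norm (H z t)) \<le>
            (LINT t|lborel. norm (W z) * ((norm (u (t - fst z)))\<^sup>2 + (norm (v t))\<^sup>2))"
          by (intro integral_mono integrable_norm H_int_t dom_int H_le)
        also have "\<dots> = norm (W z) * U"
          by (simp add: U_def u_shift v_int Bochner_Integration.integral_add)
        finally show ?thesis .
      qed
      then show "AE z in lborel. norm (LINT t|lborel. norm (case (z, t) of (z, t) \<Rightarrow> H z t))
          \<le> norm (norm (W z) * U)"
        by (intro AE_I2) (auto intro!: order_trans[OF _ abs_ge_self] simp: integral_nonneg)
    qed
    show "AE z in lborel. integrable lborel (\<lambda>t. case (z, t) of (z, t) \<Rightarrow> H z t)"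
      using H_int_t by simp
  qed
  \<comment> \<open>Integrating over \<open>\<xi>\<close> first produces a Gaussian in
    \<open>s\<close>, the offset of \<open>t\<close> from the midpoint of \<open>p + a\<close> and
    \<open>b\<close>. With the Gaussian in \<open>p + a - b\<close> it recombines, by
    \<open>gaussian_mult\<close> read backwards, into a product in which \<open>p\<close> occurs
    only through \<open>t - p\<close>.\<close>
  have xi_int: "(LINT \<xi>|lborel. H (p, \<xi>) t) =
      complex_of_real (sqrt 2 ^ CARD('n)) *
        (u (t - p) * gaussian (t - p - a)) * (gaussian (t - b) * cnj (v t))" for p t
  proof -
    define s where "s = t - (1/2) *\<^sub>R (p + a + b)"
    have "H (p, \<xi>) t = complex_of_real (exp (- (pi / 2 * (norm (p + a - b))\<^sup>2))) *
          (u (t - p) * cnj (v t)) *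
        exp (complex_of_real (- (pi / 2 * (norm \<xi>)\<^sup>2)) + \<i> * complex_of_real (((2 * pi) *\<^sub>R s) \<bullet> \<xi>))" for \<xi>
    proof -
      have *: "complex_of_real (- (pi / 2 * ((norm (p + a - b))\<^sup>2 + (norm \<xi>)\<^sup>2))) -
          \<i> * complex_of_real (pi * (\<xi> \<bullet> (a + b))) +
          \<i> * complex_of_real (2 * pi * (\<xi> \<bullet> t) - pi * (p \<bullet> \<xi>)) =
        complex_of_real (- (pi / 2 * (norm (p + a - b))\<^sup>2)) +
        (complex_of_real (- (pi / 2 * (norm \<xi>)\<^sup>2)) + \<i> * complex_of_real (((2 * pi) *\<^sub>R s) \<bullet> \<xi>))"
        by (simp add: s_def inner_commute[of \<xi>] algebra_simps)
      have "H (p, \<xi>) t = exp (complex_of_real (- (pi / 2 * ((norm (p + a - b))\<^sup>2 + (norm \<xi>)\<^sup>2))) -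
          \<i> * complex_of_real (pi * (\<xi> \<bullet> (a + b))) +
          \<i> * complex_of_real (2 * pi * (\<xi> \<bullet> t) - pi * (p \<bullet> \<xi>))) * (u (t - p) * cnj (v t))"
        unfolding H_def W_def rho_zero fst_conv snd_conv exp_add by (simp only: mult_ac)
      then show ?thesis
        unfolding * exp_add[of "complex_of_real (- (pi / 2 * (norm (p + a - b))\<^sup>2))"] exp_of_real
        by (simp only: mult_ac)
    qed
    then have "(LINT \<xi>|lborel. H (p, \<xi>) t) =
        complex_of_real (exp (- (pi / 2 * (norm (p + a - b))\<^sup>2))) * (u (t - p) * cnj (v t)) *
        (LINT \<xi>|lborel. exp (complex_of_real (- (pi / 2 * (norm \<xi>)\<^sup>2)) +
          \<i> * complex_of_real (((2 * pi) *\<^sub>R s) \<bullet> \<xi>)))"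
      by (simp only: integral_mult_right_zero)
    also have "(LINT \<xi>|lborel. exp (complex_of_real (- (pi / 2 * (norm \<xi>)\<^sup>2)) +
          \<i> * complex_of_real (((2 * pi) *\<^sub>R s) \<bullet> \<xi>))) =
        complex_of_real (sqrt (pi / (pi / 2)) ^ DIM(real^'n) *
          exp (- (norm ((2 * pi) *\<^sub>R s))\<^sup>2 / (4 * (pi / 2))))"
      using gaussian_fourier[of "pi / 2" "(2 * pi) *\<^sub>R s"] by (simp add: has_bochner_integral_iff)
    also have "- (norm ((2 * pi) *\<^sub>R s))\<^sup>2 / (4 * (pi / 2)) = - (2 * pi * (norm s)\<^sup>2)"
      by (simp add: power_mult_distrib power2_eq_square)
    also have "pi / (pi / 2) = 2" by simp
    finally have "(LINT \<xi>|lborel. H (p, \<xi>) t) = complex_of_real (sqrt 2 ^ CARD('n)) *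
        (u (t - p) * cnj (v t)) * (complex_of_real (exp (- (pi / 2 * (norm (p + a - b))\<^sup>2)) *
          exp (- (2 * pi * (norm s)\<^sup>2))))"
      by (simp add: mult_ac)
    also have "complex_of_real (exp (- (pi / 2 * (norm (p + a - b))\<^sup>2)) * exp (- (2 * pi * (norm s)\<^sup>2)))
        = gaussian (t - p - a) * gaussian (t - b)"
      using gaussian_mult[of t "p + a" b] by (simp add: s_def diff_diff_eq)
    finally show ?thesis by (simp add: mult_ac)
  qed
  have z_int: "(LINT z|lborel. H z t) = complex_of_real (sqrt 2 ^ CARD('n)) *
      L2_inner u (\<lambda>t. gaussian (t - a)) * (gaussian (t - b) * cnj (v t))"
    if int: "integrable lborel (\<lambda>z. H z t)" for t
  proof -
    have "(LINT z|lborel. H z t) = (LINT p|lborel. LINT \<xi>|lborel. H (p, \<xi>) t)"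
      using int unfolding lborel_prod[symmetric] by (rule lborel_pair.integral_fst'[symmetric])
    also have "\<dots> = complex_of_real (sqrt 2 ^ CARD('n)) *
        (LINT p|lborel. u (t - p) * gaussian (t - p - a)) * (gaussian (t - b) * cnj (v t))"
      unfolding xi_int by (simp only: integral_mult_right_zero integral_mult_left_zero)
    \<comment> \<open>The substitution \<open>s = t - p\<close> removes the remaining dependence of
      this factor on \<open>t\<close>, which makes the average a rank-one expression.\<close>
    also have "(LINT p|lborel. u (t - p) * gaussian (t - p - a)) = (LINT s|lborel. u s * gaussian (s - a))"
      using integral_lborel_isometry[of "\<lambda>s. u s * gaussian (s - a)" "- 1" t] by simp
    also have "\<dots> = L2_inner u (\<lambda>t. gaussian (t - a))"
      by (simp add: L2_inner_def gaussian_eq)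
    finally show ?thesis .
  qed
  have "(LINT z|lborel. W z * L2_inner (rho (fst z) (snd z) 0 u) v) = (LINT z|lborel. LINT t|lborel. H z t)"
    by (simp add: H_def L2_inner_def)
  also have "\<dots> = (LINT t|lborel. LINT z|lborel. H z t)"
    by (rule lborel_pair.Fubini_integral[symmetric, OF H_int])
  also have "\<dots> = (LINT t|lborel. complex_of_real (sqrt 2 ^ CARD('n)) *
      L2_inner u (\<lambda>t. gaussian (t - a)) * (gaussian (t - b) * cnj (v t)))"
  \<comment> \<open>\<open>z_int\<close> needs integrability of the slice, which Fubini's theorem
    gives for almost every \<open>t\<close>.\<close>
  proof (rule integral_cong_AE)
    show "(\<lambda>t. LINT z|lborel. H z t) \<in> borel_measurable lborel"
      using lborel_pair.integrable_snd[OF H_int] by (rule borel_measurable_integrable)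
    show "AE t in lborel. (LINT z|lborel. H z t) = complex_of_real (sqrt 2 ^ CARD('n)) *
      L2_inner u (\<lambda>t. gaussian (t - a)) * (gaussian (t - b) * cnj (v t))"
      using lborel_pair.AE_integrable_snd[OF H_int] by eventually_elim (rule z_int)
  qed measurable
  also have "\<dots> = complex_of_real (sqrt 2 ^ CARD('n)) *
      (L2_inner u (\<lambda>t. gaussian (t - a)) * L2_inner (\<lambda>t. gaussian (t - b)) v)"
    by (simp add: L2_inner_def)
  finally show ?thesis
    unfolding W_def by (simp add: case_prod_beta')
qed

section \<open>Metaplectic matrix coefficients\<close>

lemma L2_inner_cong:
  assumes "L2_eq f f'" "L2_eq g g'" "f \<in> L2" "f' \<in> L2" "g \<in> L2" "g' \<in> L2"
  shows "L2_inner f g = L2_inner f' g'"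
proof -
  have [measurable]: "f \<in> borel_measurable borel" "f' \<in> borel_measurable borel"
    "g \<in> borel_measurable borel" "g' \<in> borel_measurable borel"
    using assms by (auto simp: L2_def)
  have "AE x in lborel. f x * cnj (g x) = f' x * cnj (g' x)"
    using assms(1,2) unfolding L2_eq_def by eventually_elim simp
  then show ?thesis unfolding L2_inner_def by (intro integral_cong_AE) auto
qed

lemma L2_eq_refl: "L2_eq f f"
  by (simp add: L2_eq_def)

lemma L2_eq_sym: "L2_eq f g \<Longrightarrow> L2_eq g f"
  by (auto simp: L2_eq_def)

lemma L2_inner_cnj: "cnj (L2_inner f g) = L2_inner g f"
  unfolding L2_inner_def Bochner_Integration.integral_cnj[symmetric] by (simp add: mult.commute)

text \<open>Replacing \<open>g\<close> by \<open>U (V g)\<close> leaves the inner product unchanged,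
  and then \<open>U\<close> can be cancelled in both arguments.\<close>

lemma L2_unitary_adjoint:
  assumes U: "L2_unitary U" and V: "L2_inverse U V" and f: "f \<in> L2" and g: "g \<in> L2"
  shows "L2_inner (U f) g = L2_inner f (V g)"
proof -
  have in_L2: "U f \<in> L2" "V g \<in> L2" "U (V g) \<in> L2"
    using U V f g unfolding L2_unitary_def L2_inverse_def L2_operator_def by auto
  have "L2_inner (U f) g = L2_inner (U f) (U (V g))"
    using V g in_L2 by (intro L2_inner_cong[OF L2_eq_refl L2_eq_sym]) (auto simp: L2_inverse_def)
  also have "\<dots> = L2_inner f (V g)"
    using U f in_L2 by (auto simp: L2_unitary_def)
  finally show ?thesis .
qed

lemma block_matrix_mult_stack:
  "block_matrix A B C D *v stack x \<xi> = stack (A *v x + B *v \<xi>) (C *v x + D *v \<xi>)"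
proof (rule vec_eq_iff[THEN iffD2], rule allI)
  fix i :: "'a + 'a"
  have "(block_matrix A B C D *v stack x \<xi>) $ i =
      (\<Sum>j\<in>UNIV. block_matrix A B C D $ i $ Inl j * stack x \<xi> $ Inl j) +
      (\<Sum>j\<in>UNIV. block_matrix A B C D $ i $ Inr j * stack x \<xi> $ Inr j)"
    unfolding matrix_vector_mult_def
    by (simp add: UNIV_Plus_UNIV[symmetric] sum.Plus del: UNIV_Plus_UNIV)
  then show "(block_matrix A B C D *v stack x \<xi>) $ i =
      stack (A *v x + B *v \<xi>) (C *v x + D *v \<xi>) $ i"
    by (cases i) (simp_all add: block_matrix_def stack_def matrix_vector_mult_def)
qed

lemma rho_gaussian_inner:
  fixes p \<xi> :: "real^'n::finite"
  shows "L2_inner (rho p \<xi> 0 (\<lambda>t. gaussian (t - a))) (\<lambda>t. gaussian (t - b)) =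
    complex_of_real (sqrt (1/2) ^ CARD('n)) *
      exp (complex_of_real (- (pi / 2 * ((norm (p + a - b))\<^sup>2 + (norm \<xi>)\<^sup>2))) +
        \<i> * complex_of_real (pi * (\<xi> \<bullet> (a + b))))"
proof -
  have "L2_inner (rho p \<xi> 0 (\<lambda>t. gaussian (t - a))) (\<lambda>t. gaussian (t - b)) =
      (LINT t|lborel. exp (- (\<i> * complex_of_real (pi * (p \<bullet> \<xi>)))) *
        (exp (\<i> * complex_of_real (2 * pi * (\<xi> \<bullet> t))) * (gaussian (t - (p + a)) * gaussian (t - b))))"
    unfolding L2_inner_def
  proof (rule Bochner_Integration.integral_cong[OF refl])
    fix t
    have "cnj (gaussian (t - b)) = gaussian (t - b)" by (simp add: gaussian_eq)
    then show "rho p \<xi> 0 (\<lambda>t. gaussian (t - a)) t * cnj (gaussian (t - b)) =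
        exp (- (\<i> * complex_of_real (pi * (p \<bullet> \<xi>)))) *
        (exp (\<i> * complex_of_real (2 * pi * (\<xi> \<bullet> t))) * (gaussian (t - (p + a)) * gaussian (t - b)))"
      by (simp add: rho_zero right_diff_distrib exp_diff exp_minus diff_diff_eq field_simps)
  qed
  also have "\<dots> = exp (- (\<i> * complex_of_real (pi * (p \<bullet> \<xi>)))) *
     (complex_of_real (sqrt (1/2) ^ CARD('n)) *
      exp (complex_of_real (- (pi / 2 * ((norm (p + a - b))\<^sup>2 + (norm \<xi>)\<^sup>2))) +
        \<i> * complex_of_real (pi * (\<xi> \<bullet> (p + a + b)))))"
    by (simp only: integral_mult_right_zero gaussian_translate_fourier) simp
  also have "\<dots> = complex_of_real (sqrt (1/2) ^ CARD('n)) *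
     exp (- (\<i> * complex_of_real (pi * (p \<bullet> \<xi>))) +
      (complex_of_real (- (pi / 2 * ((norm (p + a - b))\<^sup>2 + (norm \<xi>)\<^sup>2))) +
        \<i> * complex_of_real (pi * (\<xi> \<bullet> (p + a + b)))))"
    unfolding exp_add by (simp only: mult_ac)
  \<comment> \<open>The symmetric phase in \<open>rho\<close> cancels the \<open>p\<close> that the
    translation contributes to the midpoint phase, leaving only \<open>a + b\<close>.\<close>
  also have "- (\<i> * complex_of_real (pi * (p \<bullet> \<xi>))) +
      (complex_of_real (- (pi / 2 * ((norm (p + a - b))\<^sup>2 + (norm \<xi>)\<^sup>2))) +
        \<i> * complex_of_real (pi * (\<xi> \<bullet> (p + a + b)))) =
      complex_of_real (- (pi / 2 * ((norm (p + a - b))\<^sup>2 + (norm \<xi>)\<^sup>2))) +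
        \<i> * complex_of_real (pi * (\<xi> \<bullet> (a + b)))"
    by (simp add: inner_add_right inner_commute[of p] algebra_simps)
  finally show ?thesis .
qed

section \<open>The smoothed kernel as a matrix coefficient\<close>

lemma gaussian_reflect_schwartz: "(\<lambda>t. gaussian (y - t)) \<in> schwartz" for y :: "'a::euclidean_space"
proof -
  define q where "q t = complex_of_real (- pi) * complex_of_real ((t + - y) \<bullet> (t + - y))" for t :: 'a
  have "cpoly q"
    unfolding q_def by (intro cpoly.mult cpoly.const cpoly_inner_affine bounded_linear_ident)
  have Re_q: "Re (q t) \<le> pi * (norm y)\<^sup>2 - pi / 2 * (norm t)\<^sup>2" for t
  proof -
    \<comment> \<open>Half of this square is exactly the gap in the inequality that follows.\<close>
    have "0 \<le> (norm (t - 2 *\<^sub>R y))\<^sup>2" by simp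
    then have "(norm t)\<^sup>2 / 2 - (norm y)\<^sup>2 \<le> (t + - y) \<bullet> (t + - y)"
      unfolding power2_norm_eq_inner by (simp add: algebra_simps inner_commute)
    from mult_left_mono[OF this pi_ge_zero] show ?thesis by (simp add: q_def algebra_simps)
  qed
  have "(\<lambda>t. 1 * exp (q t)) \<in> schwartz"
    by (rule cpoly_exp_schwartz[OF cpoly.const \<open>cpoly q\<close> Re_q]) simp
  moreover have "1 * exp (q t) = gaussian (y - t)" for t
    unfolding gaussian_minus_commute[of y t]
    unfolding gaussian_eq q_def
    by (simp add: power2_norm_eq_inner exp_of_real[symmetric])
  ultimately show ?thesis by simp
qed

text \<open>The Gaussian on the product space is a tensor product of Gaussians, so the defining
  property of the kernel applies. As the Gaussian is real and even, reflections and conjugation do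
  not change it.\<close>

lemma kernel_gaussian_convolution:
  assumes "schwartz_kernel k (\<lambda>f. distr_of_fun (T f))"
  shows "distr_convolution k gaussian (x, y) =
    L2_inner (T (\<lambda>t. gaussian (t - y))) (\<lambda>t. gaussian (t - x))"
proof -
  have "distr_convolution k gaussian (x, y) = k (\<lambda>(s, t). gaussian (x - s) * gaussian (y - t))"
    unfolding distr_convolution_def
    by (rule arg_cong[where f = k]) (auto simp: fun_eq_iff gaussian_Pair)
  also have "\<dots> = distr_of_fun (T (\<lambda>t. gaussian (y - t))) (\<lambda>s. gaussian (x - s))"
    using assms gaussian_reflect_schwartz unfolding schwartz_kernel_def by metis
  also have "\<dots> = L2_inner (T (\<lambda>t. gaussian (t - y))) (\<lambda>t. gaussian (t - x))"
    unfolding distr_of_fun_def L2_inner_def gaussian_minus_commute[of y] gaussian_minus_commute[of x]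
    by (simp add: gaussian_eq)
  finally show ?thesis .
qed

text \<open>The exponent of the averaging weight for \<open>y0\<close> and \<open>y\<close> plus
  that of the coefficient of \<open>rho\<close> at the symplectic image of \<open>(p, \<xi>)\<close>
  between the Gaussians at \<open>x0\<close> and \<open>x\<close>. The nested pairs separate the
  parameters \<open>(x, y)\<close> from the integration variables.\<close>

definition kernel_phase ::
  "real^'n^'n \<Rightarrow> real^'n^'n \<Rightarrow> real^'n^'n \<Rightarrow> real^'n^'n \<Rightarrow> real^'n \<Rightarrow> real^'n \<Rightarrow>
    ((real^'n) \<times> (real^'n)) \<times> ((real^'n) \<times> (real^'n::finite)) \<Rightarrow> complex" where
  "kernel_phase A B C D x0 y0 = (\<lambda>((x, y), (p, \<xi>)).
    complex_of_real (- (pi / 2 * ((norm (p + y0 - y))\<^sup>2 + (norm \<xi>)\<^sup>2 +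
      (norm (A *v p + B *v \<xi> + x0 - x))\<^sup>2 + (norm (C *v p + D *v \<xi>))\<^sup>2))) +
    \<i> * complex_of_real (pi * ((C *v p + D *v \<xi>) \<bullet> (x0 + x) - \<xi> \<bullet> (y0 + y))))"

text \<open>\<open>rho_gaussian_average\<close> is applied with \<open>u = V (G x0)\<close>,
  \<open>v = V (G x)\<close>, \<open>a = y0\<close> and \<open>b = y\<close>. Moving
  \<open>V\<close> across as the adjoint of \<open>U\<close> gives the left side; the intertwining
  relation makes the integrand explicit.\<close>

lemma metaplectic_gaussian_coefficient:
  fixes A B C D :: "real^'n::finite^'n"
  assumes "metaplectic (block_matrix A B C D) U"
  defines "h \<equiv> \<lambda>x y. L2_inner (U (\<lambda>t. gaussian (t - y))) (\<lambda>t. gaussian (t - x))"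
  shows "complex_of_real (2 ^ CARD('n)) * (cnj (h x0 y0) * h x y) =
    (LINT (p, \<xi>)|lborel. exp (kernel_phase A B C D x0 y0 ((x, y), (p, \<xi>))))"
proof -
  define G where "G y = (\<lambda>t. gaussian (t - y))" for y :: "real^'n"
  have G: "G y \<in> L2" for y unfolding G_def by (rule gaussian_translate_L2)
  obtain V where U: "L2_unitary U" and V: "L2_inverse U V"
    and inter: "\<And>x \<xi> x' \<xi>' \<tau> f. block_matrix A B C D *v stack x \<xi> = stack x' \<xi>' \<Longrightarrow> f \<in> L2 \<Longrightarrow>
      L2_eq (U (rho x \<xi> \<tau> (V f))) (rho x' \<xi>' \<tau> f)"
    using assms(1) unfolding metaplectic_def by blast
  have UL2: "U f \<in> L2" and VL2: "V f \<in> L2" if "f \<in> L2" for f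
    using U V that unfolding L2_unitary_def L2_inverse_def L2_operator_def by auto
  define W where "W p \<xi> = exp (complex_of_real (- (pi / 2 * ((norm (p + y0 - y))\<^sup>2 + (norm \<xi>)\<^sup>2))) -
        \<i> * complex_of_real (pi * (\<xi> \<bullet> (y0 + y))))" for p \<xi> :: "real^'n"
  have h: "h x y = L2_inner (G y) (V (G x))" for x y
    unfolding h_def G_def[symmetric] by (rule L2_unitary_adjoint[OF U V G G])
  have "complex_of_real (sqrt 2 ^ CARD('n)) * (cnj (h x0 y0) * h x y) =
      (LINT (p, \<xi>)|lborel. W p \<xi> * L2_inner (rho p \<xi> 0 (V (G x0))) (V (G x)))"
    unfolding h L2_inner_cnj W_def rho_gaussian_average[OF VL2[OF G] VL2[OF G]]
    unfolding G_def ..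
  also have "\<dots> = (LINT z|lborel. complex_of_real (sqrt (1/2) ^ CARD('n)) * (case z of (p, \<xi>) \<Rightarrow> exp (kernel_phase A B C D x0 y0 ((x, y), (p, \<xi>)))))"
  proof (rule Bochner_Integration.integral_cong[OF refl], clarify)
    fix p \<xi> :: "real^'n"
    define p' \<xi>' where "p' = A *v p + B *v \<xi>" and "\<xi>' = C *v p + D *v \<xi>"
    have "L2_inner (rho p \<xi> 0 (V (G x0))) (V (G x)) = L2_inner (U (rho p \<xi> 0 (V (G x0)))) (G x)"
      by (rule L2_unitary_adjoint[OF U V _ G, symmetric]) (intro rho_zero_L2 VL2 G)
    also have "\<dots> = L2_inner (rho p' \<xi>' 0 (G x0)) (G x)"
      unfolding p'_def \<xi>'_def
      by (intro L2_inner_cong inter block_matrix_mult_stack L2_eq_refl UL2 rho_zero_L2 VL2 G)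
    also have "\<dots> = complex_of_real (sqrt (1/2) ^ CARD('n)) *
      exp (complex_of_real (- (pi / 2 * ((norm (p' + x0 - x))\<^sup>2 + (norm \<xi>')\<^sup>2))) +
        \<i> * complex_of_real (pi * (\<xi>' \<bullet> (x0 + x))))"
      unfolding G_def by (rule rho_gaussian_inner)
    finally have "W p \<xi> * L2_inner (rho p \<xi> 0 (V (G x0))) (V (G x)) =
      complex_of_real (sqrt (1/2) ^ CARD('n)) * (W p \<xi> *
      exp (complex_of_real (- (pi / 2 * ((norm (p' + x0 - x))\<^sup>2 + (norm \<xi>')\<^sup>2))) +
        \<i> * complex_of_real (pi * (\<xi>' \<bullet> (x0 + x)))))"
      by (simp only: mult_ac)
    also have "W p \<xi> *
      exp (complex_of_real (- (pi / 2 * ((norm (p' + x0 - x))\<^sup>2 + (norm \<xi>')\<^sup>2))) +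
        \<i> * complex_of_real (pi * (\<xi>' \<bullet> (x0 + x)))) =
      exp (kernel_phase A B C D x0 y0 ((x, y), (p, \<xi>)))"
      unfolding W_def exp_add[symmetric]
      by (rule arg_cong[where f = exp]) (simp add: kernel_phase_def p'_def \<xi>'_def algebra_simps)
    finally show "W p \<xi> * L2_inner (rho p \<xi> 0 (V (G x0))) (V (G x)) =
      complex_of_real (sqrt (1/2) ^ CARD('n)) * exp (kernel_phase A B C D x0 y0 ((x, y), (p, \<xi>)))"
      .
  qed
  finally have *: "complex_of_real (sqrt 2 ^ CARD('n)) * (cnj (h x0 y0) * h x y) =
      complex_of_real (sqrt (1/2) ^ CARD('n)) * (LINT (p, \<xi>)|lborel. exp (kernel_phase A B C D x0 y0 ((x, y), (p, \<xi>))))" (is "_ * ?L = _ * ?R")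
    by (simp only: integral_mult_right_zero)
  \<comment> \<open>Multiplying by a further \<open>sqrt 2 ^ CARD('n)\<close> clears the constant on
    the right and makes the one on the left \<open>2 ^ CARD('n)\<close>.\<close>
  have s: "sqrt 2 ^ CARD('n) * sqrt 2 ^ CARD('n) = 2 ^ CARD('n)"
    "sqrt 2 ^ CARD('n) * sqrt (1/2) ^ CARD('n) = 1"
    by (simp_all add: power_mult_distrib[symmetric] real_sqrt_mult[symmetric])
  have "complex_of_real (2 ^ CARD('n)) * ?L =
      complex_of_real (sqrt 2 ^ CARD('n)) * (complex_of_real (sqrt 2 ^ CARD('n)) * ?L)"
    unfolding s(1)[symmetric] by (simp only: of_real_mult mult.assoc)
  also have "\<dots> = complex_of_real (sqrt 2 ^ CARD('n) * sqrt (1/2) ^ CARD('n)) * ?R"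
    unfolding * by (simp only: of_real_mult mult.assoc)
  finally show ?thesis unfolding s(2) by simp
qed

section \<open>Coercivity of the phase and decay off the diagonal\<close>

text \<open>The right side is the squared norm of \<open>L w + a\<close> with \<open>L\<close>
  linear and \<open>a\<close> fixed. Invertibility of \<open>C\<close> makes \<open>L\<close>
  injective, hence bounded below in finite dimension, and the shift \<open>a\<close> costs only a
  constant.\<close>

lemma gaussian_phase_coercive:
  fixes A B C D :: "real^'n::finite^'n"
  assumes "invertible C"
  shows "\<exists>c>0. \<exists>K. \<forall>x y p \<xi>. c * (norm ((x, y), (p, \<xi>)))\<^sup>2 - K \<le>
    (norm (p + y0 - y))\<^sup>2 + (norm \<xi>)\<^sup>2 +
    (norm (A *v p + B *v \<xi> + x0 - x))\<^sup>2 + (norm (C *v p + D *v \<xi>))\<^sup>2"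
proof -
  define L :: "((real^'n) \<times> (real^'n)) \<times> ((real^'n) \<times> (real^'n)) \<Rightarrow>
      (real^'n) \<times> (real^'n) \<times> (real^'n) \<times> (real^'n)" where
    "L w = (fst (snd w) - snd (fst w), snd (snd w),
      A *v fst (snd w) + B *v snd (snd w) - fst (fst w), C *v fst (snd w) + D *v snd (snd w))" for w
  have lin: "linear L"
    by (rule linearI)
      (auto simp: L_def matrix_vector_right_distrib matrix_vector_mult_scaleR algebra_simps)
  have "w = 0" if "L w = 0" for w
  proof -
    obtain x y p \<xi> where w: "w = ((x, y), (p, \<xi>))" by (metis surj_pair)
    have "p = y" "\<xi> = 0" "A *v p + B *v \<xi> = x" "C *v p + D *v \<xi> = 0"
      using that by (auto simp: L_def w zero_prod_def)
    \<comment> \<open>With \<open>\<xi> = 0\<close> the last component reads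
      \<open>C *v p = 0\<close>; this is where invertibility of \<open>C\<close> enters. Then
      \<open>y\<close> and \<open>x\<close> vanish as well.\<close>
    moreover from this have "p = 0"
      using assms by (metis add.right_neutral invertible_eq_bij matrix_vector_mult_0_right
          bij_is_inj injD)
    ultimately show ?thesis by (simp add: w zero_prod_def)
  qed
  then have "inj L" by (simp add: linear_injective_0[OF lin])
  then obtain b where b: "b > 0" "\<And>w. b * norm w \<le> norm (L w)"
    using linear_inj_bounded_below_pos[OF lin] by blast
  define a :: "(real^'n) \<times> (real^'n) \<times> (real^'n) \<times> (real^'n)" where "a = (y0, 0, x0, 0)"
  have "b\<^sup>2 / 2 * (norm ((x, y), (p, \<xi>)))\<^sup>2 - (norm a)\<^sup>2 \<le>
    (norm (p + y0 - y))\<^sup>2 + (norm \<xi>)\<^sup>2 +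
    (norm (A *v p + B *v \<xi> + x0 - x))\<^sup>2 + (norm (C *v p + D *v \<xi>))\<^sup>2" for x y p \<xi>
  proof -
    let ?w = "((x, y), (p, \<xi>))"
    have "b\<^sup>2 * (norm ?w)\<^sup>2 \<le> (norm (L ?w))\<^sup>2"
      using power_mono[OF b(2)[of ?w], of 2] b(1) by (simp add: power_mult_distrib)
    also have "(norm (L ?w))\<^sup>2 \<le> 2 * (norm (L ?w + a))\<^sup>2 + 2 * (norm a)\<^sup>2"
    proof -
      \<comment> \<open>This square is the difference of the two sides of the claim.\<close>
      have "0 \<le> (norm (L ?w + 2 *\<^sub>R a))\<^sup>2" by simp
      then show ?thesis
        unfolding power2_norm_eq_inner by (simp add: algebra_simps inner_commute)
    qed
    also have "(norm (L ?w + a))\<^sup>2 = (norm (p + y0 - y))\<^sup>2 + (norm \<xi>)\<^sup>2 +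
      (norm (A *v p + B *v \<xi> + x0 - x))\<^sup>2 + (norm (C *v p + D *v \<xi>))\<^sup>2"
      by (simp add: L_def a_def norm_Pair algebra_simps)
    finally show ?thesis by simp
  qed
  moreover have "b\<^sup>2 / 2 > 0" using b by simp
  ultimately show ?thesis by blast
qed

lemma kernel_phase_integral_schwartz:
  fixes A B C D :: "real^'n::finite^'n"
  assumes "invertible C"
  shows "(\<lambda>x. LINT z|lborel. r * exp (kernel_phase A B C D x0 y0 (x, z))) \<in> schwartz"
proof -
  define l1 l2 l3 l4 l5 l6
    :: "((real^'n) \<times> (real^'n)) \<times> ((real^'n) \<times> (real^'n)) \<Rightarrow> real^'n"
    where "l1 = (\<lambda>w. fst (snd w) - snd (fst w))" and "l2 = (\<lambda>w. snd (snd w))"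
    and "l3 = (\<lambda>w. A *v fst (snd w) + B *v snd (snd w) - fst (fst w))"
    and "l4 = (\<lambda>w. C *v fst (snd w) + D *v snd (snd w))"
    and "l5 = (\<lambda>w. fst (fst w))" and "l6 = (\<lambda>w. snd (fst w))"
  have lin: "bounded_linear l1" "bounded_linear l2" "bounded_linear l3"
    "bounded_linear l4" "bounded_linear l5" "bounded_linear l6"
    unfolding l1_def l2_def l3_def l4_def l5_def l6_def
    by (intro bounded_linear_add bounded_linear_sub
        bounded_linear_compose[OF matrix_vector_mul_bounded_linear]
        bounded_linear_compose[OF bounded_linear_fst] bounded_linear_compose[OF bounded_linear_snd]
        bounded_linear_fst bounded_linear_snd)+
  \<comment> \<open>The phase rewritten so that the closure rules for \<open>cpoly\<close> match
    syntactically: every inner product has affine arguments, hence the summands \<open>+ 0\<close>,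
    and subtraction becomes multiplication by \<open>- 1\<close>.\<close>
  define q where "q w =
      complex_of_real (- (pi / 2)) * (complex_of_real ((l1 w + y0) \<bullet> (l1 w + y0)) +
        complex_of_real ((l2 w + 0) \<bullet> (l2 w + 0)) + complex_of_real ((l3 w + x0) \<bullet> (l3 w + x0)) +
        complex_of_real ((l4 w + 0) \<bullet> (l4 w + 0))) +
      (\<i> * complex_of_real pi) * (complex_of_real ((l4 w + 0) \<bullet> (l5 w + x0)) +
        - 1 * complex_of_real ((l2 w + 0) \<bullet> (l6 w + y0)))" for w
  have "cpoly q"
    unfolding q_def by (intro cpoly.add cpoly.mult cpoly.const cpoly_inner_affine lin)
  have q_eq: "kernel_phase A B C D x0 y0 w = q w" for w
  proof -
    obtain x y p \<xi> where w: "w = ((x, y), (p, \<xi>))" by (metis surj_pair)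
    have l: "l1 ((x, y), (p, \<xi>)) + y0 = p + y0 - y"
      "l3 ((x, y), (p, \<xi>)) + x0 = A *v p + B *v \<xi> + x0 - x"
      "l2 ((x, y), (p, \<xi>)) = \<xi>" "l4 ((x, y), (p, \<xi>)) = C *v p + D *v \<xi>"
      "l5 ((x, y), (p, \<xi>)) + x0 = x0 + x" "l6 ((x, y), (p, \<xi>)) + y0 = y0 + y"
      by (simp_all add: l1_def l2_def l3_def l4_def l5_def l6_def)
    show ?thesis
      unfolding w kernel_phase_def prod.case q_def l add_0_right power2_norm_eq_inner
      by (simp only: of_real_mult of_real_add of_real_diff of_real_minus mult_minus_left
          mult_1_left diff_conv_add_uminus mult.assoc)
  qed
  obtain c K where c: "c > 0" and K: "\<And>x y p \<xi>. c * (norm ((x, y), (p, \<xi>)))\<^sup>2 - K \<le>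
    (norm (p + y0 - y))\<^sup>2 + (norm \<xi>)\<^sup>2 +
    (norm (A *v p + B *v \<xi> + x0 - x))\<^sup>2 + (norm (C *v p + D *v \<xi>))\<^sup>2"
    using gaussian_phase_coercive[OF assms] by blast
  have Re_q: "Re (q w) \<le> pi / 2 * K - pi / 2 * c * (norm w)\<^sup>2" for w
  proof -
    obtain x y p \<xi> where w: "w = ((x, y), (p, \<xi>))" by (metis surj_pair)
    have "pi / 2 * (c * (norm w)\<^sup>2 - K) \<le> pi / 2 * ((norm (p + y0 - y))\<^sup>2 + (norm \<xi>)\<^sup>2 +
    (norm (A *v p + B *v \<xi> + x0 - x))\<^sup>2 + (norm (C *v p + D *v \<xi>))\<^sup>2)"
      unfolding w by (intro mult_left_mono K) simp
    moreover have "Re (q w) = - (pi / 2 * ((norm (p + y0 - y))\<^sup>2 + (norm \<xi>)\<^sup>2 +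
    (norm (A *v p + B *v \<xi> + x0 - x))\<^sup>2 + (norm (C *v p + D *v \<xi>))\<^sup>2))"
      unfolding q_eq[symmetric] w kernel_phase_def by simp
    ultimately show ?thesis by (simp add: right_diff_distrib)
  qed
  show ?thesis
    unfolding q_eq
    by (rule cpoly_exp_integral_schwartz[OF cpoly.const \<open>cpoly q\<close> Re_q]) (use c in simp)
qed

text \<open>Decay in the full variable \<open>(x, y)\<close> is stronger than decay away from the
  diagonal, because \<open>japanese (x - y)\<close> is at most twice
  \<open>japanese (x, y)\<close>.\<close>

lemma schwartz_imp_diagonal_kernel:
  assumes "h \<in> schwartz"
  shows "diagonal_kernel h"
  unfolding diagonal_kernel_def
proof (intro conjI allI impI)
  have "h differentiable (at z)" for z
    using assms unfolding schwartz_def smooth_def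
    by (metis (mono_tags, lifting) empty_subsetI iter_deriv.simps(1) list.set(1) mem_Collect_eq)
  then show "continuous_on UNIV h"
    by (simp add: continuous_at_imp_continuous_on differentiable_imp_continuous_within)
  fix N :: int
  assume N: "N > 0"
  define n where "n = nat N"
  have "bdd_above (range (\<lambda>z. japanese z ^ n * norm (iter_deriv [] h z)))"
    using assms unfolding schwartz_def by (auto simp del: iter_deriv.simps)
  then obtain M where M: "\<And>z. japanese z ^ n * norm (h z) \<le> M"
    by (auto simp: bdd_above_def)
  \<comment> \<open>The absolute value and the summand 1 make the constant strictly positive, as
    \<open>diagonal_kernel\<close> demands.\<close>
  have "norm (h (x, y)) \<le> (2 ^ n * \<bar>M\<bar> + 1) * japanese (x - y) powi (- N)" for x y
  proof -
    have pos: "japanese (x - y) > 0" by (simp add: japanese_def add_pos_nonneg)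
    have le: "(norm (x - y))\<^sup>2 \<le> 2 * (norm (x, y))\<^sup>2"
    proof -
      have "0 \<le> (norm (x + y))\<^sup>2" by simp
      then show ?thesis
        unfolding power2_norm_eq_inner by (simp add: algebra_simps inner_commute)
    qed
    have "1 + (norm (x - y))\<^sup>2 \<le> 4 * (1 + (norm (x, y))\<^sup>2)"
      using le by (smt (verit) zero_le_power2)
    then have "sqrt (1 + (norm (x - y))\<^sup>2) \<le> sqrt (4 * (1 + (norm (x, y))\<^sup>2))"
      by (rule real_sqrt_le_mono)
    then have "japanese (x - y) \<le> 2 * japanese (x, y)"
      unfolding japanese_def real_sqrt_mult real_sqrt_four .
    then have "japanese (x - y) ^ n \<le> 2 ^ n * japanese (x, y) ^ n"
      using power_mono[of "japanese (x - y)" "2 * japanese (x, y)" n] pos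
      by (simp add: power_mult_distrib)
    then have "japanese (x - y) ^ n * norm (h (x, y)) \<le> 2 ^ n * japanese (x, y) ^ n * norm (h (x, y))"
      by (rule mult_right_mono) simp
    also have "\<dots> \<le> 2 ^ n * M"
      using M[of "(x, y)"] by (simp add: mult.assoc)
    also have "\<dots> \<le> 2 ^ n * \<bar>M\<bar> + 1"
      by (simp add: add_increasing2)
    finally have "norm (h (x, y)) \<le> (2 ^ n * \<bar>M\<bar> + 1) / japanese (x - y) ^ n"
      using pos by (simp add: pos_le_divide_eq mult.commute)
    then show ?thesis
      using N by (simp add: n_def power_int_minus power_int_def divide_inverse power_inverse)
  qed
  then show "\<exists>C>0. \<forall>x y. norm (h (x, y)) \<le> C * japanese (x - y) powi (- N)"
    by (intro exI[of _ "2 ^ n * \<bar>M\<bar> + 1"]) (auto intro: add_nonneg_pos)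
qed

theorem proposition3p2:
  fixes A B C D :: "real^'n::finite^'n"
    and S_hat :: "(real^'n \<Rightarrow> complex) \<Rightarrow> (real^'n \<Rightarrow> complex)"
    and k :: "((real^'n) \<times> (real^'n) \<Rightarrow> complex) \<Rightarrow> complex"
  assumes "block_matrix A B C D \<in> Sp"
    and "metaplectic (block_matrix A B C D) S_hat"
    and "schwartz_kernel k (\<lambda>f. distr_of_fun (S_hat f))"
    and "invertible C"
  shows "distr_convolution k gaussian \<in> schwartz \<and> quasi_diagonal k"
proof -
  define h where "h x y = L2_inner (S_hat (\<lambda>t. gaussian (t - y))) (\<lambda>t. gaussian (t - x))" for x y
  have conv: "distr_convolution k gaussian = (\<lambda>(x, y). h x y)"
    using kernel_gaussian_convolution[OF assms(3)] by (auto simp: fun_eq_iff h_def)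
  have "distr_convolution k gaussian \<in> schwartz"
  proof (cases "\<forall>x y. h x y = 0")
    case True
    \<comment> \<open>The vanishing kernel is the same kind of integral with prefactor 0, so both
      cases end with the same lemma.\<close>
    then have "distr_convolution k gaussian =
        (\<lambda>x. LINT z|lborel. 0 * exp (kernel_phase A B C D 0 0 (x, z)))"
      unfolding conv by auto
    then show ?thesis by (simp only: kernel_phase_integral_schwartz[OF assms(4)])
  next
    case False
    then obtain x0 y0 where "h x0 y0 \<noteq> 0" by blast
    \<comment> \<open>Everything in the coefficient formula that does not depend on
      \<open>(x, y)\<close>; it is nonzero by the choice of the reference point
      \<open>(x0, y0)\<close>.\<close>
    define r where "r = complex_of_real (2 ^ CARD('n)) * cnj (h x0 y0)"
    have "r \<noteq> 0" using \<open>h x0 y0 \<noteq> 0\<close> by (simp add: r_def)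
    have "r * h x y = (LINT z|lborel. exp (kernel_phase A B C D x0 y0 ((x, y), z)))" for x y
      using metaplectic_gaussian_coefficient[OF assms(2), where ?x0.0 = x0 and ?y0.0 = y0 and x = x and y = y, folded h_def]
      by (simp add: r_def mult.assoc case_prod_beta')
    then have "distr_convolution k gaussian =
        (\<lambda>x. LINT z|lborel. 1 / r * exp (kernel_phase A B C D x0 y0 (x, z)))"
      unfolding conv integral_mult_right_zero using \<open>r \<noteq> 0\<close>
      by (auto simp: fun_eq_iff field_simps)
    then show ?thesis by (simp only: kernel_phase_integral_schwartz[OF assms(4)])
  qed
  then show ?thesis
    using assms(3) schwartz_imp_diagonal_kernel by (auto simp: quasi_diagonal_def schwartz_kernel_def)
qed

end
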